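(* Let $X\in 2^\omega$ be non-computable, anti-complex, and proper. Then $X$ is high.
   Context: $X$ is high if $X'\ge_{\mathrm T}\emptyset''$, equivalently if $X$ computes a function that dominates every computable function. All measures are Borel probability measures on Cantor space $2^\omega$. A measure $\mu$ is computable if $\sigma\mapsto\mu(\{X:\sigma\prec X\})$ is a computable real-valued function on finite binary strings. A $\mu$-Martin-Löf test is a uniformly $\Sigma^0_1$ sequence $(\mathcal U_i)_{i\in\omega}$ with $\mu(\mathcal U_i)\le 2^{-i}$; $X$ is $\mu$-Martin-Löf random if $X\notin\bigcap_i\mathcal U_i$ for every such test. $X$ is proper if it is $\mu$-Martin-Löf random for some computable measure $\mu$. $\mathrm K$ is prefix-free Kolmogorov complexity; $X\upharpoonright n$ is the initial segment of $X$ of length $n$; an order is a non-decreasing unbounded function $h:\omega\to\omega$ with $h(0)=0$. $X$ is anti-complex if for every computable order $h$, $\mathrm K(X\upharpoonright h(n))\le n$ for all but finitely many $n$. *)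

theory Defs
  imports "HOL-Probability.Probability" "HOL-Library.Nat_Bijection"
    "HOL-Library.Extended_Nat" "HOL-Library.Sublist"
begin

section \<open>Relative computability\<close>

text \<open>Points of Cantor space, which also serve as subsets of the natural numbers,
  have type \<^typ>\<open>nat \<Rightarrow> bool\<close>. Programs are the partial recursive function schemes
  with an extra basic function for the sequence \<open>A\<close> that is being queried. All functions are
  unary; several arguments are passed through the pairing \<^const>\<open>prod_encode\<close>.\<close>

datatype prog =
    Zero
  | Succ
  | Fst
  | Snd
  | Query
  | Pair prog prog
  | Comp prog prog
  | Prec prog prog
  | Mu prog

primrec eval :: "(nat \<Rightarrow> bool) \<Rightarrow> prog \<Rightarrow> nat \<Rightarrow> nat option" where
  "eval A Zero x = Some 0"
| "eval A Succ x = Some (Suc x)"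
| "eval A Fst x = Some (fst (prod_decode x))"
| "eval A Snd x = Some (snd (prod_decode x))"
| "eval A Query x = Some (of_bool (A x))"
| "eval A (Pair f g) x =
     Option.bind (eval A f x) (\<lambda>y. Option.bind (eval A g x) (\<lambda>z. Some (prod_encode (y, z))))"
| "eval A (Comp f g) x = Option.bind (eval A g x) (eval A f)"
| "eval A (Prec f g) x =
     rec_nat (eval A f (fst (prod_decode x)))
       (\<lambda>k r. Option.bind r (\<lambda>y.
          eval A g (prod_encode (fst (prod_decode x), prod_encode (k, y)))))
       (snd (prod_decode x))"
| "eval A (Mu f) x =
     (if \<exists>k. eval A f (prod_encode (x, k)) = Some 0 \<and>
             (\<forall>j<k. eval A f (prod_encode (x, j)) \<noteq> None)
      then Some (LEAST k. eval A f (prod_encode (x, k)) = Some 0)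
      else None)"

text \<open>The Goedel numbering is a bijection, so that every natural number is an index.\<close>

primrec prog_code :: "prog \<Rightarrow> nat" where
  "prog_code Zero = 0"
| "prog_code Succ = 1"
| "prog_code Fst = 2"
| "prog_code Snd = 3"
| "prog_code Query = 4"
| "prog_code (Pair f g) = 5 + 4 * prod_encode (prog_code f, prog_code g)"
| "prog_code (Comp f g) = 6 + 4 * prod_encode (prog_code f, prog_code g)"
| "prog_code (Prec f g) = 7 + 4 * prod_encode (prog_code f, prog_code g)"
| "prog_code (Mu f) = 8 + 4 * prog_code f"

definition computable_in :: "(nat \<Rightarrow> bool) \<Rightarrow> (nat \<Rightarrow> nat) \<Rightarrow> bool" where
  "computable_in A f \<longleftrightarrow> (\<exists>c. \<forall>x. eval A c x = Some (f x))"

definition turing_le :: "(nat \<Rightarrow> bool) \<Rightarrow> (nat \<Rightarrow> bool) \<Rightarrow> bool" where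
  "turing_le A B \<longleftrightarrow> computable_in B (\<lambda>n. of_bool (A n))"

definition empty_seq :: "nat \<Rightarrow> bool" where
  "empty_seq = (\<lambda>_. False)"

definition computable :: "(nat \<Rightarrow> nat) \<Rightarrow> bool" where
  "computable f \<longleftrightarrow> computable_in empty_seq f"

definition computable_seq :: "(nat \<Rightarrow> bool) \<Rightarrow> bool" where
  "computable_seq X \<longleftrightarrow> computable (\<lambda>n. of_bool (X n))"

definition computably_enumerable :: "nat set \<Rightarrow> bool" where
  "computably_enumerable W \<longleftrightarrow> (\<exists>c. W = {x. eval empty_seq c x \<noteq> None})"

definition jump :: "(nat \<Rightarrow> bool) \<Rightarrow> nat \<Rightarrow> bool" where
  "jump A e \<longleftrightarrow> (\<exists>c. prog_code c = e \<and> eval A c e \<noteq> None)"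

definition high :: "(nat \<Rightarrow> bool) \<Rightarrow> bool" where
  "high X \<longleftrightarrow> turing_le (jump (jump empty_seq)) (jump X)"


section \<open>Strings and prefix-free complexity\<close>

text \<open>The bijective base-2 numeral of a string, least significant digit first.\<close>

primrec str_code :: "bool list \<Rightarrow> nat" where
  "str_code [] = 0"
| "str_code (b # \<sigma>) = 2 * str_code \<sigma> + (if b then 2 else 1)"

definition init_seg :: "(nat \<Rightarrow> bool) \<Rightarrow> nat \<Rightarrow> bool list" where
  "init_seg X n = map X [0..<n]"

definition partial_computable_str :: "(bool list \<Rightarrow> bool list option) \<Rightarrow> bool" where
  "partial_computable_str M \<longleftrightarrow>
     (\<exists>c. \<forall>\<sigma>. eval empty_seq c (str_code \<sigma>) = map_option str_code (M \<sigma>))"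

definition prefix_free_machine :: "(bool list \<Rightarrow> bool list option) \<Rightarrow> bool" where
  "prefix_free_machine M \<longleftrightarrow> partial_computable_str M \<and>
     (\<forall>p\<in>dom M. \<forall>q\<in>dom M. prefix p q \<longrightarrow> p = q)"

definition complexity :: "(bool list \<Rightarrow> bool list option) \<Rightarrow> bool list \<Rightarrow> enat" where
  "complexity M \<sigma> = (INF p\<in>{p. M p = Some \<sigma>}. enat (length p))"

text \<open>For an optimal machine \<open>U\<close>, the function \<open>complexity U\<close> is prefix-free Kolmogorov
  complexity.\<close>

definition optimal_machine :: "(bool list \<Rightarrow> bool list option) \<Rightarrow> bool" where
  "optimal_machine U \<longleftrightarrow> prefix_free_machine U \<and>
     (\<forall>M. prefix_free_machine M \<longrightarrow> (\<exists>c::nat. \<forall>\<sigma>. complexity U \<sigma> \<le> complexity M \<sigma> + enat c))"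

definition order_fun :: "(nat \<Rightarrow> nat) \<Rightarrow> bool" where
  "order_fun h \<longleftrightarrow> mono h \<and> (\<forall>m. \<exists>n. m \<le> h n) \<and> h 0 = 0"

definition anti_complex :: "(bool list \<Rightarrow> bool list option) \<Rightarrow> (nat \<Rightarrow> bool) \<Rightarrow> bool" where
  "anti_complex U X \<longleftrightarrow> (\<forall>h. computable h \<and> order_fun h \<longrightarrow>
     (\<forall>\<^sub>F n in sequentially. complexity U (init_seg X (h n)) \<le> enat n))"


section \<open>Computable measures and randomness\<close>

definition cylinder :: "bool list \<Rightarrow> (nat \<Rightarrow> bool) set" where
  "cylinder \<sigma> = {X. init_seg X (length \<sigma>) = \<sigma>}"

text \<open>The Borel sets of \<^typ>\<open>nat \<Rightarrow> bool\<close> are those of the product topology.\<close>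

definition borel_prob :: "(nat \<Rightarrow> bool) measure \<Rightarrow> bool" where
  "borel_prob \<mu> \<longleftrightarrow> prob_space \<mu> \<and> sets \<mu> = sets borel"

definition rat_decode :: "nat \<Rightarrow> rat" where
  "rat_decode r =
     of_int (int_decode (fst (prod_decode r))) / of_nat (Suc (snd (prod_decode r)))"

definition computable_real_fun :: "(bool list \<Rightarrow> real) \<Rightarrow> bool" where
  "computable_real_fun F \<longleftrightarrow> (\<exists>q. computable q \<and>
     (\<forall>\<sigma> n. \<bar>F \<sigma> - of_rat (rat_decode (q (prod_encode (str_code \<sigma>, n))))\<bar> \<le> (1/2) ^ n))"

definition computable_measure :: "(nat \<Rightarrow> bool) measure \<Rightarrow> bool" where
  "computable_measure \<mu> \<longleftrightarrow> computable_real_fun (\<lambda>\<sigma>. measure \<mu> (cylinder \<sigma>))"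

definition uniformly_Sigma01 :: "(nat \<Rightarrow> (nat \<Rightarrow> bool) set) \<Rightarrow> bool" where
  "uniformly_Sigma01 \<U> \<longleftrightarrow> (\<exists>W. computably_enumerable W \<and>
     (\<forall>i. \<U> i = (\<Union>\<sigma>\<in>{\<sigma>. prod_encode (i, str_code \<sigma>) \<in> W}. cylinder \<sigma>)))"

definition ml_test :: "(nat \<Rightarrow> bool) measure \<Rightarrow> (nat \<Rightarrow> (nat \<Rightarrow> bool) set) \<Rightarrow> bool" where
  "ml_test \<mu> \<U> \<longleftrightarrow> uniformly_Sigma01 \<U> \<and> (\<forall>i. measure \<mu> (\<U> i) \<le> (1/2) ^ i)"

definition ml_random :: "(nat \<Rightarrow> bool) measure \<Rightarrow> (nat \<Rightarrow> bool) \<Rightarrow> bool" where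
  "ml_random \<mu> X \<longleftrightarrow> (\<forall>\<U>. ml_test \<mu> \<U> \<longrightarrow> X \<notin> (\<Inter>i. \<U> i))"

definition proper :: "(nat \<Rightarrow> bool) \<Rightarrow> bool" where
  "proper X \<longleftrightarrow> (\<exists>\<mu>. borel_prob \<mu> \<and> computable_measure \<mu> \<and> ml_random \<mu> X)"


section \<open>Bijectivity of the encodings\<close>

lemma prog_code_inject: "prog_code c = prog_code d \<Longrightarrow> c = d"
proof (induction c arbitrary: d)
  case (Pair f g) then show ?case by (cases d) (auto, presburger+)
next
  case (Comp f g) then show ?case by (cases d) (auto, presburger+)
next
  case (Prec f g) then show ?case by (cases d) (auto, presburger+)
next
  case (Mu f) then show ?case by (cases d) (auto, presburger+)
qed (case_tac d; simp)+

lemma prog_code_surj: "\<exists>c. prog_code c = n"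
proof (induction n rule: less_induct)
  case (less n)
  show ?case
  proof (cases "n < 5")
    case True
    then have "n = 0 \<or> n = 1 \<or> n = 2 \<or> n = 3 \<or> n = 4" by arith
    then show ?thesis
      by (elim disjE) (metis prog_code.simps(1-5))+
  next
    case False
    define m where "m = (n - 5) div 4"
    have n: "n = 5 + 4 * m \<or> n = 6 + 4 * m \<or> n = 7 + 4 * m \<or> n = 8 + 4 * m"
      using False unfolding m_def by presburger
    obtain a b where ab: "m = prod_encode (a, b)"
      by (metis prod_decode_inverse surj_pair)
    have "a \<le> m" "b \<le> m" "m < n"
      using ab le_prod_encode_1 le_prod_encode_2 n by auto
    then obtain f g e where "prog_code f = a" "prog_code g = b" "prog_code e = m"
      using less.IH by (meson le_less_trans)
    then show ?thesis
      using n ab by (metis prog_code.simps(6-9))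
  qed
qed

lemma bij_prog_code: "bij prog_code"
  unfolding bij_def inj_def surj_def using prog_code_inject prog_code_surj by metis

lemma str_code_inject: "str_code \<sigma> = str_code \<tau> \<Longrightarrow> \<sigma> = \<tau>"
proof (induction \<sigma> arbitrary: \<tau>)
  case Nil then show ?case by (cases \<tau>) (auto split: if_splits)
next
  case (Cons b \<sigma>) then show ?case
    by (cases \<tau>) (auto split: if_splits, presburger+)
qed

lemma str_code_surj: "\<exists>\<sigma>. str_code \<sigma> = n"
proof (induction n rule: less_induct)
  case (less n)
  show ?case
  proof (cases "n = 0")
    case True then show ?thesis by (metis str_code.simps(1))
  next
    case False
    then have n: "n = 2 * ((n - 1) div 2) + 1 \<or> n = 2 * ((n - 1) div 2) + 2" by presburger
    obtain \<sigma> where "str_code \<sigma> = (n - 1) div 2" using less.IH[of "(n - 1) div 2"] False by fastforce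
    then show ?thesis using n by (metis str_code.simps(2))
  qed
qed

lemma bij_str_code: "bij str_code"
  unfolding bij_def inj_def surj_def using str_code_inject str_code_surj by metis

end

theory Submission
  imports Defs
begin

text \<open>
  Why the theorem holds. Let \<open>X\<close> be random for the computable measure \<open>\<mu>\<close>, and write
  \<open>X|m\<close> for its initial segments. Two estimates on \<open>\<mu> (X|m)\<close> are played against each other.

  From below, randomness gives \<open>\<mu> (X|m) \<ge> 2 ^ -(K (X|m) + c)\<close>: the strings \<open>\<sigma>\<close> with
  \<open>\<mu> \<sigma> \<le> 2 ^ -(K \<sigma> + i)\<close> generate a Martin-Loef test, its measure being controlled by
  Kraft's inequality (\<open>random_complexity_lower_bound\<close>). If \<open>X\<close> is anti-complex this yields
  \<open>\<mu> (X|h n) \<ge> 2 ^ -(n + c)\<close> for every computable order \<open>h\<close> and almost all \<open>n\<close>.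

  From above, \<open>\<mu> (X|m)\<close> tends to \<open>0\<close>. Otherwise the path \<open>X\<close> would keep a positive mass, and
  from some level on it would be the only extension to do so; following the heavy extension
  would then compute \<open>X\<close> (\<open>computable_if_not_null\<close>). Hence \<open>X\<close> computes a function \<open>g\<close> with
  \<open>\<mu> (X|g n) < 2 ^ -(2n - 1)\<close>. Since \<open>2n - 1\<close> eventually exceeds \<open>n + c\<close>, whatever \<open>c\<close> is, we
  get \<open>h n < g n\<close> for almost all \<open>n\<close>, so \<open>g\<close> dominates every computable function.

  A function dominating all computable functions makes \<open>X\<close> high (\<open>high_if_dominating\<close>).
  Membership of \<open>e\<close> in the second jump of the empty set has the form
  \<open>\<exists>n. \<forall>s\<ge>n. H e n s\<close> with \<open>H\<close> decidable. If \<open>e\<close> is not a member, the search for a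
  counterexample \<open>s\<close> to each \<open>n\<close> is a total computable function, so for almost all \<open>n\<close> it
  succeeds below \<open>g n\<close>; this gives non-membership the form \<open>\<exists>\<forall>\<close> relative to \<open>X\<close> as well,
  and the jump of \<open>X\<close> can look for a witness of either form. To have a decidable \<open>H\<close>,
  uniformly in the index \<open>e\<close>, programs are interpreted by programs: the input-output facts that
  are derivable in \<open>n\<close> rounds form a finite set computed by primitive recursion on \<open>n\<close>.
\<close>

section \<open>Closure properties of relative computability\<close>

abbreviation pfst :: "nat \<Rightarrow> nat" where "pfst z \<equiv> fst (prod_decode z)"
abbreviation psnd :: "nat \<Rightarrow> nat" where "psnd z \<equiv> snd (prod_decode z)"

abbreviation decidable_in :: "(nat \<Rightarrow> bool) \<Rightarrow> (nat \<Rightarrow> bool) \<Rightarrow> bool" where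
  "decidable_in A P \<equiv> computable_in A (\<lambda>x. of_bool (P x))"

text \<open>These rules are stated so that computability of an explicit term in one variable is proved by
  structural recursion on the term.\<close>

named_theorems computable_intros

lemma computable_in_const [computable_intros]: "computable_in A (\<lambda>_. n)"
proof (induction n)
  case 0
  show ?case unfolding computable_in_def by (rule exI[of _ Zero]) simp
next
  case (Suc n)
  then obtain c where "\<forall>x. eval A c x = Some n" unfolding computable_in_def by blast
  then show ?case unfolding computable_in_def by (intro exI[of _ "Comp Succ c"]) simp
qed

lemma computable_in_id [computable_intros]: "computable_in A (\<lambda>x. x)"
  unfolding computable_in_def by (rule exI[of _ "Pair Fst Snd"]) simp

lemma computable_in_comp:
  assumes "computable_in A f" "computable_in A g"
  shows "computable_in A (\<lambda>x. f (g x))"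
proof -
  obtain c d where "\<forall>x. eval A c x = Some (f x)" "\<forall>x. eval A d x = Some (g x)"
    using assms unfolding computable_in_def by blast
  then show ?thesis unfolding computable_in_def by (intro exI[of _ "Comp c d"]) simp
qed

lemma computable_in_prod_encode [computable_intros]:
  assumes "computable_in A f" "computable_in A g"
  shows "computable_in A (\<lambda>x. prod_encode (f x, g x))"
proof -
  obtain c d where "\<forall>x. eval A c x = Some (f x)" "\<forall>x. eval A d x = Some (g x)"
    using assms unfolding computable_in_def by blast
  then show ?thesis unfolding computable_in_def by (intro exI[of _ "Pair c d"]) simp
qed

lemma computable_in_Suc [computable_intros]:
  assumes "computable_in A f" shows "computable_in A (\<lambda>x. Suc (f x))"
  by (rule computable_in_comp[OF _ assms])
    (auto simp: computable_in_def intro: exI[of _ Succ])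

lemma computable_in_pfst [computable_intros]:
  assumes "computable_in A f" shows "computable_in A (\<lambda>x. pfst (f x))"
  by (rule computable_in_comp[OF _ assms])
    (auto simp: computable_in_def intro: exI[of _ Fst])

lemma computable_in_psnd [computable_intros]:
  assumes "computable_in A f" shows "computable_in A (\<lambda>x. psnd (f x))"
  by (rule computable_in_comp[OF _ assms])
    (auto simp: computable_in_def intro: exI[of _ Snd])

lemma decidable_in_oracle:
  assumes "computable_in A f" shows "decidable_in A (\<lambda>x. A (f x))"
  by (rule computable_in_comp[OF _ assms])
    (auto simp: computable_in_def intro: exI[of _ Query])

text \<open>The step function is given all of its arguments curried, while its computability is
  stated after packing them into one number; this lets the rule be applied by unification, with
  the bound variables of the recursion turning into projections of the packed argument.\<close>

lemma computable_in_rec_nat [computable_intros]: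
  assumes b: "computable_in A b"
    and s: "computable_in A (\<lambda>z. s (pfst z) (pfst (psnd z)) (psnd (psnd z)))"
    and n: "computable_in A n"
  shows "computable_in A (\<lambda>x. rec_nat (b x) (s x) (n x))"
proof -
  obtain cb where cb: "\<And>x. eval A cb x = Some (b x)"
    using b unfolding computable_in_def by blast
  obtain cs where cs: "\<And>z. eval A cs z = Some (s (pfst z) (pfst (psnd z)) (psnd (psnd z)))"
    using s unfolding computable_in_def by blast
  obtain cn where cn: "\<And>x. eval A cn x = Some (n x)"
    using n unfolding computable_in_def by blast
  have rec: "eval A (Prec cb cs) (prod_encode (x, k)) = Some (rec_nat (b x) (s x) k)" for x k
    by (induction k) (simp_all add: cb cs)
  have "eval A (Comp (Prec cb cs) (Pair (Pair Fst Snd) cn)) x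
    = Some (rec_nat (b x) (s x) (n x))" for x
    using rec[of x "n x"] by (simp add: cn del: eval.simps(8))
  then show ?thesis unfolding computable_in_def by blast
qed

lemma computable_in_add [computable_intros]:
  assumes "computable_in A f" "computable_in A g"
  shows "computable_in A (\<lambda>x. f x + g x)"
proof -
  have eq: "rec_nat a (\<lambda>_ r. Suc r) b = a + b" for a b by (induction b) auto
  have "computable_in A (\<lambda>x. rec_nat (f x) (\<lambda>_ r. Suc r) (g x))"
    by (intro computable_intros assms)
  then show ?thesis by (simp only: eq)
qed

lemma computable_in_diff [computable_intros]:
  assumes "computable_in A f" "computable_in A g"
  shows "computable_in A (\<lambda>x. f x - g x)"
proof -
  have eq: "rec_nat a (\<lambda>_ r. rec_nat 0 (\<lambda>k _. k) r) b = a - b" for a b :: nat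
  proof (induction b)
    case (Suc b)
    have "rec_nat 0 (\<lambda>k _. k) r = r - 1" for r :: nat by (cases r) auto
    then show ?case using Suc by simp
  qed simp
  have "computable_in A (\<lambda>x. rec_nat (f x) (\<lambda>_ r. rec_nat 0 (\<lambda>k _. k) r) (g x))"
    by (intro computable_intros assms)
  then show ?thesis by (simp only: eq)
qed

lemma computable_in_mult [computable_intros]:
  assumes "computable_in A f" "computable_in A g"
  shows "computable_in A (\<lambda>x. f x * g x)"
proof -
  have eq: "rec_nat 0 (\<lambda>_ r. r + a) b = a * b" for a b :: nat by (induction b) auto
  have "computable_in A (\<lambda>x. rec_nat 0 (\<lambda>_ r. r + f x) (g x))"
    by (intro computable_intros assms computable_in_comp[OF assms(1)])
  then show ?thesis by (simp only: eq)
qed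

lemma computable_in_power [computable_intros]:
  assumes "computable_in A f" "computable_in A g"
  shows "computable_in A (\<lambda>x. f x ^ g x)"
proof -
  have eq: "rec_nat 1 (\<lambda>_ r. r * a) b = a ^ b" for a b :: nat by (induction b) auto
  have "computable_in A (\<lambda>x. rec_nat 1 (\<lambda>_ r. r * f x) (g x))"
    by (intro computable_intros assms computable_in_comp[OF assms(1)])
  then show ?thesis by (simp only: eq)
qed

lemma computable_in_sum [computable_intros]:
  assumes f: "computable_in A (\<lambda>z. f (pfst z) (psnd z))" and n: "computable_in A n"
  shows "computable_in A (\<lambda>x. \<Sum>k<n x. f x k :: nat)"
proof -
  have eq: "rec_nat 0 (\<lambda>k r. r + h k) m = (\<Sum>k<m. h k :: nat)" for h m
    by (induction m) auto
  have f': "computable_in A (\<lambda>z. f (pfst z) (pfst (psnd z)))"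
    using computable_in_comp[OF f, of "\<lambda>z. prod_encode (pfst z, pfst (psnd z))"]
    by (simp add: computable_intros)
  have "computable_in A (\<lambda>x. rec_nat 0 (\<lambda>k r. r + f x k) (n x))"
    by (intro computable_intros assms f')
  then show ?thesis by (simp only: eq)
qed

lemma decidable_in_Not [computable_intros]:
  assumes "decidable_in A P" shows "decidable_in A (\<lambda>x. \<not> P x)"
proof -
  have "computable_in A (\<lambda>x. 1 - of_bool (P x))" by (intro computable_intros assms)
  moreover have "(1 - of_bool (P x) :: nat) = of_bool (\<not> P x)" for x by simp
  ultimately show ?thesis by (simp only:)
qed

lemma decidable_in_conj [computable_intros]:
  assumes "decidable_in A P" "decidable_in A Q" shows "decidable_in A (\<lambda>x. P x \<and> Q x)"
  unfolding of_bool_conj by (intro computable_intros assms)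

lemma decidable_in_disj [computable_intros]:
  assumes "decidable_in A P" "decidable_in A Q" shows "decidable_in A (\<lambda>x. P x \<or> Q x)"
proof -
  have "decidable_in A (\<lambda>x. \<not> (\<not> P x \<and> \<not> Q x))" by (intro computable_intros assms)
  then show ?thesis by simp
qed

lemma decidable_in_imp [computable_intros]:
  assumes "decidable_in A P" "decidable_in A Q" shows "decidable_in A (\<lambda>x. P x \<longrightarrow> Q x)"
  unfolding imp_conv_disj by (intro computable_intros assms)

lemma decidable_in_le [computable_intros]:
  assumes "computable_in A f" "computable_in A g" shows "decidable_in A (\<lambda>x. f x \<le> g x)"
proof -
  have "computable_in A (\<lambda>x. 1 - (f x - g x))" by (intro computable_intros assms)
  moreover have "1 - (f x - g x) = of_bool (f x \<le> g x)" for x by simp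
  ultimately show ?thesis by (simp only:)
qed

lemma decidable_in_less [computable_intros]:
  assumes "computable_in A f" "computable_in A g" shows "decidable_in A (\<lambda>x. f x < g x)"
  unfolding less_eq_Suc_le by (intro computable_intros assms)

lemma decidable_in_eq [computable_intros]:
  fixes f g :: "nat \<Rightarrow> nat"
  assumes "computable_in A f" "computable_in A g" shows "decidable_in A (\<lambda>x. f x = g x)"
  unfolding order_eq_iff by (intro computable_intros assms)

lemma computable_in_if [computable_intros]:
  assumes "decidable_in A P" "computable_in A f" "computable_in A g"
  shows "computable_in A (\<lambda>x. if P x then f x else g x)"
proof -
  have "computable_in A (\<lambda>x. of_bool (P x) * f x + of_bool (\<not> P x) * g x)"
    by (intro computable_intros assms)
  moreover have "of_bool (P x) * f x + of_bool (\<not> P x) * g x = (if P x then f x else g x)" for x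
    by simp
  ultimately show ?thesis by (simp only:)
qed

lemma decidable_in_if [computable_intros]:
  assumes "decidable_in A P" "decidable_in A Q" "decidable_in A R"
  shows "decidable_in A (\<lambda>x. if P x then Q x else R x)"
  unfolding if_bool_eq_conj by (intro computable_intros assms)

lemma decidable_in_Bex [computable_intros]:
  assumes "decidable_in A (\<lambda>z. P (pfst z) (psnd z))" "computable_in A n"
  shows "decidable_in A (\<lambda>x. \<exists>k<n x. P x k)"
proof -
  have "(\<exists>k<m. Q k) = (0 < (\<Sum>k<m. of_bool (Q k) :: nat))" for m :: nat and Q
    by (auto simp flip: neq0_conv)
  then show ?thesis by (simp only:) (intro computable_intros assms)
qed

lemma decidable_in_Ball [computable_intros]:
  assumes "decidable_in A (\<lambda>z. P (pfst z) (psnd z))" "computable_in A n"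
  shows "decidable_in A (\<lambda>x. \<forall>k<n x. P x k)"
proof -
  have "decidable_in A (\<lambda>x. \<not> (\<exists>k<n x. \<not> P x k))" by (intro computable_intros assms)
  then show ?thesis by simp
qed

lemma computable_in_div [computable_intros]:
  assumes "computable_in A f" "computable_in A g"
  shows "computable_in A (\<lambda>x. f x div g x)"
proof -
  have eq: "a div b = (\<Sum>k<a. of_bool (0 < b \<and> Suc k * b \<le> a))" for a b :: nat
  proof (cases "b = 0")
    case False
    then have "(\<Sum>k<a. of_bool (0 < b \<and> Suc k * b \<le> a)) = card {k. k < a \<and> Suc k * b \<le> a}"
      by (simp add: sum.If_cases of_bool_def Int_def)
    also have "{k. k < a \<and> Suc k * b \<le> a} = {..<a div b}"
    proof (rule set_eqI)
      fix k
      have "Suc k \<le> a div b \<longleftrightarrow> Suc k * b \<le> a"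
        using False less_eq_div_iff_mult_less_eq[of b "Suc k" a] by simp
      then show "k \<in> {k. k < a \<and> Suc k * b \<le> a} \<longleftrightarrow> k \<in> {..<a div b}"
        using div_le_dividend[of a b] by (auto simp del: mult_Suc div_le_dividend)
    qed
    finally show ?thesis by simp
  qed simp
  show ?thesis
    unfolding eq
    by (intro computable_intros assms computable_in_comp[OF assms(1)] computable_in_comp[OF assms(2)])
qed

lemma computable_in_mod [computable_intros]:
  assumes "computable_in A f" "computable_in A g"
  shows "computable_in A (\<lambda>x. f x mod g x)"
  unfolding modulo_nat_def by (intro computable_intros assms)

lemma decidable_in_odd [computable_intros]:
  assumes "computable_in A f"
  shows "decidable_in A (\<lambda>x. odd (f x))"
  unfolding odd_iff_mod_2_eq_one by (intro computable_intros assms)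

lemma decidable_in_set_decode [computable_intros]:
  assumes "computable_in A f" "computable_in A g"
  shows "decidable_in A (\<lambda>x. f x \<in> set_decode (g x))"
  unfolding set_decode_def mem_Collect_eq by (intro computable_intros assms)

lemma computable_in_Least [computable_intros]:
  assumes P: "decidable_in A (\<lambda>z. P (pfst z) (psnd z))" and ex: "\<And>x. \<exists>k. P x k"
  shows "computable_in A (\<lambda>x. LEAST k. P x k)"
proof -
  have "decidable_in A (\<lambda>z. \<not> P (pfst z) (psnd z))" by (intro computable_intros P)
  then obtain c where c: "\<And>z. eval A c z = Some (of_bool (\<not> P (pfst z) (psnd z)))"
    unfolding computable_in_def by blast
  have "eval A (Mu c) x = Some (LEAST k. P x k)" for x
    using ex[of x] by (simp add: c)
  then show ?thesis unfolding computable_in_def by blast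
qed

text \<open>Unbounded search over a decidable predicate: every \<open>\<Sigma>\<^sub>1\<close> predicate is a halting set.\<close>

lemma halting_program:
  assumes P: "decidable_in A (\<lambda>z. P (pfst z) (psnd z))"
  obtains c where "\<And>x. eval A c x \<noteq> None \<longleftrightarrow> (\<exists>k. P x k)"
proof -
  have "decidable_in A (\<lambda>z. \<not> P (pfst z) (psnd z))" by (intro computable_intros P)
  then obtain c where c: "\<And>z. eval A c z = Some (of_bool (\<not> P (pfst z) (psnd z)))"
    unfolding computable_in_def by blast
  have "eval A (Mu c) x \<noteq> None \<longleftrightarrow> (\<exists>k. P x k)" for x by (simp add: c)
  then show thesis by (rule that)
qed

text \<open>Replacing queries by the constant \<open>0\<close> turns a program into one that behaves, under any
  oracle, as the original does under the empty oracle.\<close>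

primrec no_query :: "prog \<Rightarrow> prog" where
  "no_query Zero = Zero"
| "no_query Succ = Succ"
| "no_query Fst = Fst"
| "no_query Snd = Snd"
| "no_query Query = Zero"
| "no_query (Pair f g) = Pair (no_query f) (no_query g)"
| "no_query (Comp f g) = Comp (no_query f) (no_query g)"
| "no_query (Prec f g) = Prec (no_query f) (no_query g)"
| "no_query (Mu f) = Mu (no_query f)"

lemma eval_no_query: "eval A (no_query c) = eval empty_seq c"
  by (induction c) (rule ext; simp add: empty_seq_def)+

lemma computable_imp_computable_in: "computable f \<Longrightarrow> computable_in A f"
  unfolding computable_def computable_in_def using eval_no_query by metis

section \<open>A clocked universal machine\<close>

text \<open>The number \<open>\<langle>c, \<langle>x, y\<rangle>\<rangle>\<close> stands for the fact that the program coded by \<open>c\<close> maps \<open>x\<close> to \<open>y\<close>. A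
  fact is justified by a set \<open>T\<close> of facts if one clause of the evaluation function derives it
  from facts in \<open>T\<close>. Below, \<open>r\<close> is the outermost constructor of a compound program and \<open>m\<close> the
  code of its components. Intermediate values \<open>z\<close> are bounded by \<open>n\<close> to keep the predicate
  decidable; nothing is lost when all members of \<open>T\<close> are below \<open>n\<close>.\<close>

definition justified :: "(nat \<Rightarrow> bool) \<Rightarrow> nat \<Rightarrow> nat set \<Rightarrow> nat \<Rightarrow> nat \<Rightarrow> nat \<Rightarrow> bool" where
  "justified A n T c x y \<longleftrightarrow>
     (let m = (c - 5) div 4; r = (c - 5) mod 4; f = pfst m; g = psnd m;
          F = (\<lambda>c x y. prod_encode (c, prod_encode (x, y)) \<in> T)
      in if c = 0 then y = 0
         else if c = 1 then y = Suc x
         else if c = 2 then y = pfst x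
         else if c = 3 then y = psnd x
         else if c = 4 then y = of_bool (A x)
         else if r = 0 then F f x (pfst y) \<and> F g x (psnd y)
         else if r = 1 then \<exists>z<n. F g x z \<and> F f z y
         else if r = 2 then
           if psnd x = 0 then F f (pfst x) y
           else \<exists>z<n. F c (prod_encode (pfst x, psnd x - 1)) z \<and>
                  F g (prod_encode (pfst x, prod_encode (psnd x - 1, z))) y
         else F m (prod_encode (x, y)) 0 \<and>
              (\<forall>j<y. \<exists>z<n. z \<noteq> 0 \<and> F m (prod_encode (x, j)) z))"

text \<open>The facts derived within \<open>n\<close> rounds. Round \<open>n\<close> only admits facts with a code below \<open>n\<close>; this
  keeps the set finite and, because a fact is at least as large as the input it mentions, also
  bounds the oracle positions that are consulted.\<close>

primrec facts :: "(nat \<Rightarrow> bool) \<Rightarrow> nat \<Rightarrow> nat set" where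
  "facts A 0 = {}"
| "facts A (Suc n) =
     {t. t < Suc n \<and> justified A n (facts A n) (pfst t) (pfst (psnd t)) (psnd (psnd t))}"

text \<open>The diagonal computation \<open>e\<close> is seen to halt within \<open>n\<close> rounds. So \<open>halts A n\<close> is the \<open>n\<close>-th
  finite approximation to the jump of \<open>A\<close>, and it can itself serve as an oracle.\<close>

definition halts :: "(nat \<Rightarrow> bool) \<Rightarrow> nat \<Rightarrow> nat \<Rightarrow> bool" where
  "halts A n e \<longleftrightarrow> (\<exists>y<n. prod_encode (e, prod_encode (e, y)) \<in> facts A n)"

lemma facts_less: "t \<in> facts A n \<Longrightarrow> t < n"
  by (cases n) auto

lemma justified_mono:
  assumes "justified A n T c x y" "T \<subseteq> T'" "n \<le> n'"
  shows "justified A n' T' c x y"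
  using assms unfolding justified_def Let_def
  by (auto split: if_splits) (meson subsetD less_le_trans)+

lemma facts_Suc_subset: "facts A n \<subseteq> facts A (Suc n)"
proof (induction n)
  case (Suc n)
  show ?case
  proof
    fix t assume "t \<in> facts A (Suc n)"
    then have "t < Suc n" "justified A n (facts A n) (pfst t) (pfst (psnd t)) (psnd (psnd t))"
      by auto
    then show "t \<in> facts A (Suc (Suc n))"
      using justified_mono[OF _ Suc.IH, of A n _ _ _ "Suc n"]
      by (simp del: facts.simps(2) add: facts.simps(2)[of A "Suc n"])
  qed
qed simp

lemma facts_mono: "n \<le> m \<Longrightarrow> facts A n \<subseteq> facts A m"
  using lift_Suc_mono_le[of "facts A", OF facts_Suc_subset] by blast

lemma halts_mono: "halts A n e \<Longrightarrow> n \<le> m \<Longrightarrow> halts A m e"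
  unfolding halts_def using facts_mono by (meson less_le_trans subsetD)

text \<open>The use principle: a query at \<open>x\<close> enters \<open>facts A n\<close> only through facts
  \<open>\<langle>c, \<langle>x, y\<rangle>\<rangle> < n\<close>, and \<open>x\<close> is at most that code.\<close>

lemma facts_use:
  assumes "\<And>k. k < n \<Longrightarrow> A k = B k"
  shows "facts A n = facts B n"
  using assms
proof (induction n)
  case (Suc n)
  have eq: "facts A n = facts B n" using Suc by simp
  have "justified A n T (pfst t) (pfst (psnd t)) (psnd (psnd t)) =
    justified B n T (pfst t) (pfst (psnd t)) (psnd (psnd t))" if "t < Suc n" for T t
  proof -
    have "pfst (psnd t) \<le> t"
      using le_prod_encode_1[of "pfst (psnd t)" "psnd (psnd t)"]
        le_prod_encode_2[of "psnd t" "pfst t"] by simp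
    then have "A (pfst (psnd t)) = B (pfst (psnd t))" using Suc.prems that by simp
    then show ?thesis unfolding justified_def by simp
  qed
  then show ?case using eq by auto
qed simp

lemma halts_use:
  assumes "\<And>k. k < n \<Longrightarrow> A k = B k"
  shows "halts A n = halts B n"
  unfolding halts_def fun_eq_iff using facts_use[OF assms] by simp

text \<open>Decoding the code of a compound program, done once for all four constructors.\<close>

lemma justified_compound:
  assumes "c = 5 + 4 * m + r" "r < 4"
  shows "justified A n T c x y \<longleftrightarrow>
     (let f = pfst m; g = psnd m; F = (\<lambda>c x y. prod_encode (c, prod_encode (x, y)) \<in> T)
      in if r = 0 then F f x (pfst y) \<and> F g x (psnd y)
         else if r = 1 then \<exists>z<n. F g x z \<and> F f z y
         else if r = 2 then
           if psnd x = 0 then F f (pfst x) y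
           else \<exists>z<n. F c (prod_encode (pfst x, psnd x - 1)) z \<and>
                  F g (prod_encode (pfst x, prod_encode (psnd x - 1, z))) y
         else F m (prod_encode (x, y)) 0 \<and>
              (\<forall>j<y. \<exists>z<n. z \<noteq> 0 \<and> F m (prod_encode (x, j)) z))"
proof -
  have c: "c \<noteq> 0" "c \<noteq> 1" "c \<noteq> 2" "c \<noteq> 3" "c \<noteq> 4" "(c - 5) div 4 = m" "(c - 5) mod 4 = r"
    using assms by auto
  show ?thesis unfolding justified_def Let_def c(6,7) using c(1-5) by (simp only: if_False)
qed

lemma justified_prog_code:
  "justified A n T (prog_code Zero) x y \<longleftrightarrow> y = 0"
  "justified A n T (prog_code Succ) x y \<longleftrightarrow> y = Suc x"
  "justified A n T (prog_code Fst) x y \<longleftrightarrow> y = pfst x"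
  "justified A n T (prog_code Snd) x y \<longleftrightarrow> y = psnd x"
  "justified A n T (prog_code Query) x y \<longleftrightarrow> y = of_bool (A x)"
  "justified A n T (prog_code (Pair f g)) x y \<longleftrightarrow>
     prod_encode (prog_code f, prod_encode (x, pfst y)) \<in> T \<and>
     prod_encode (prog_code g, prod_encode (x, psnd y)) \<in> T"
  "justified A n T (prog_code (Comp f g)) x y \<longleftrightarrow>
     (\<exists>z<n. prod_encode (prog_code g, prod_encode (x, z)) \<in> T \<and>
            prod_encode (prog_code f, prod_encode (z, y)) \<in> T)"
  "justified A n T (prog_code (Prec f g)) x y \<longleftrightarrow>
     (if psnd x = 0 then prod_encode (prog_code f, prod_encode (pfst x, y)) \<in> T
      else \<exists>z<n. prod_encode (prog_code (Prec f g),
                   prod_encode (prod_encode (pfst x, psnd x - 1), z)) \<in> T \<and>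
             prod_encode (prog_code g,
               prod_encode (prod_encode (pfst x, prod_encode (psnd x - 1, z)), y)) \<in> T)"
  "justified A n T (prog_code (Mu f)) x y \<longleftrightarrow>
     prod_encode (prog_code f, prod_encode (prod_encode (x, y), 0)) \<in> T \<and>
     (\<forall>j<y. \<exists>z<n. z \<noteq> 0 \<and> prod_encode (prog_code f, prod_encode (prod_encode (x, j), z)) \<in> T)"
proof -
  have *: "prog_code (Pair f g) = 5 + 4 * prod_encode (prog_code f, prog_code g) + 0"
    "prog_code (Comp f g) = 5 + 4 * prod_encode (prog_code f, prog_code g) + 1"
    "prog_code (Prec f g) = 5 + 4 * prod_encode (prog_code f, prog_code g) + 2"
    "prog_code (Mu f) = 5 + 4 * prog_code f + 3"
    by simp_all
  note compound = *[THEN justified_compound]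
  show "justified A n T (prog_code (Pair f g)) x y \<longleftrightarrow>
     prod_encode (prog_code f, prod_encode (x, pfst y)) \<in> T \<and>
     prod_encode (prog_code g, prod_encode (x, psnd y)) \<in> T"
    by (subst compound) (simp_all add: Let_def del: prog_code.simps)
  show "justified A n T (prog_code (Comp f g)) x y \<longleftrightarrow>
     (\<exists>z<n. prod_encode (prog_code g, prod_encode (x, z)) \<in> T \<and>
            prod_encode (prog_code f, prod_encode (z, y)) \<in> T)"
    by (subst compound) (simp_all add: Let_def del: prog_code.simps)
  show "justified A n T (prog_code (Prec f g)) x y \<longleftrightarrow>
     (if psnd x = 0 then prod_encode (prog_code f, prod_encode (pfst x, y)) \<in> T
      else \<exists>z<n. prod_encode (prog_code (Prec f g),
                   prod_encode (prod_encode (pfst x, psnd x - 1), z)) \<in> T \<and>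
             prod_encode (prog_code g,
               prod_encode (prod_encode (pfst x, prod_encode (psnd x - 1, z)), y)) \<in> T)"
    by (subst compound) (simp_all add: Let_def del: prog_code.simps)
  show "justified A n T (prog_code (Mu f)) x y \<longleftrightarrow>
     prod_encode (prog_code f, prod_encode (prod_encode (x, y), 0)) \<in> T \<and>
     (\<forall>j<y. \<exists>z<n. z \<noteq> 0 \<and> prod_encode (prog_code f, prod_encode (prod_encode (x, j), z)) \<in> T)"
    by (subst compound) (simp_all add: Let_def del: prog_code.simps)
qed (unfold justified_def Let_def prog_code.simps,
    simp_all only: if_True if_False simp_thms rel_simps numeral_One)

lemma facts_sound:
  assumes "prod_encode (prog_code c, prod_encode (x, y)) \<in> facts A n"
  shows "eval A c x = Some y"
  using assms
proof (induction n arbitrary: c x y)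
  case (Suc n)
  have j: "justified A n (facts A n) (prog_code c) x y" using Suc.prems by simp
  show ?case
  proof (cases c)
    case (Pair f g)
    then show ?thesis using j Suc.IH unfolding Pair justified_prog_code by fastforce
  next
    case (Comp f g)
    then show ?thesis using j Suc.IH unfolding Comp justified_prog_code by fastforce
  next
    case (Prec f g)
    obtain a k where x: "x = prod_encode (a, k)" by (metis prod_decode_inverse surj_pair)
    show ?thesis
    proof (cases k)
      case 0
      then show ?thesis using j Suc.IH unfolding Prec x justified_prog_code by simp
    next
      case (Suc k')
      then obtain z where
        "prod_encode (prog_code (Prec f g), prod_encode (prod_encode (a, k'), z)) \<in> facts A n"
        "prod_encode (prog_code g,
          prod_encode (prod_encode (a, prod_encode (k', z)), y)) \<in> facts A n"
        using j unfolding Prec x justified_prog_code by auto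
      then have "eval A (Prec f g) (prod_encode (a, k')) = Some z"
        "eval A g (prod_encode (a, prod_encode (k', z))) = Some y"
        using Suc.IH by blast+
      then show ?thesis unfolding Prec x Suc by simp
    qed
  next
    case (Mu f)
    have y: "eval A f (prod_encode (x, y)) = Some 0"
      using j Suc.IH unfolding Mu justified_prog_code by blast
    have below: "\<exists>z. z \<noteq> 0 \<and> eval A f (prod_encode (x, j)) = Some z" if "j < y" for j
      using j that Suc.IH unfolding Mu justified_prog_code by blast
    have "(LEAST k. eval A f (prod_encode (x, k)) = Some 0) = y"
    proof (rule Least_equality)
      show "eval A f (prod_encode (x, y)) = Some 0" by (rule y)
    next
      fix k assume "eval A f (prod_encode (x, k)) = Some 0"
      then show "y \<le> k" using below[of k] by (cases "k < y") auto
    qed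
    moreover have "\<exists>k. eval A f (prod_encode (x, k)) = Some 0 \<and>
        (\<forall>j<k. eval A f (prod_encode (x, j)) \<noteq> None)"
      using y below by fastforce
    ultimately show ?thesis unfolding Mu by simp
  qed (use j in \<open>simp_all add: justified_prog_code del: prog_code.simps\<close>)
qed simp

lemma eventually_facts:
  assumes "\<forall>\<^sub>F n in sequentially. justified A n (facts A n) c x y"
  shows "\<forall>\<^sub>F n in sequentially. prod_encode (c, prod_encode (x, y)) \<in> facts A n"
proof -
  have "\<forall>\<^sub>F n in sequentially. prod_encode (c, prod_encode (x, y)) \<in> facts A (Suc n)"
    using assms eventually_ge_at_top[of "prod_encode (c, prod_encode (x, y))"]
    by eventually_elim simp
  then show ?thesis by (subst (asm) eventually_sequentially_Suc)
qed

text \<open>Only finitely many subcomputations enter a halting computation, and each of them is eventually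
  among the facts; phrasing this with a filter avoids explicit bounds on the number of rounds.\<close>

lemma facts_complete:
  assumes "eval A c x = Some y"
  shows "\<forall>\<^sub>F n in sequentially. prod_encode (prog_code c, prod_encode (x, y)) \<in> facts A n"
  using assms
proof (induction c arbitrary: x y)
  case (Pair f g)
  then obtain u v where uv: "eval A f x = Some u" "eval A g x = Some v" "y = prod_encode (u, v)"
    by (auto simp: bind_eq_Some_conv)
  show ?case
    unfolding uv(3)
    by (intro eventually_facts, use Pair.IH(1)[OF uv(1)] Pair.IH(2)[OF uv(2)] in eventually_elim)
      (simp add: justified_prog_code del: prog_code.simps)
next
  case (Comp f g)
  then obtain z where z: "eval A g x = Some z" "eval A f z = Some y"
    by (auto simp: bind_eq_Some_conv)
  show ?case
    by (intro eventually_facts, use Comp.IH(2)[OF z(1)] Comp.IH(1)[OF z(2)]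
        eventually_gt_at_top[of z] in eventually_elim)
      (auto simp: justified_prog_code simp del: prog_code.simps)
next
  case (Prec f g)
  obtain a k where x: "x = prod_encode (a, k)" by (metis prod_decode_inverse surj_pair)
  show ?case
    using Prec.prems unfolding x
  proof (induction k arbitrary: y)
    case 0
    then have "eval A f a = Some y" by simp
    show ?case
      by (intro eventually_facts, use Prec.IH(1)[OF \<open>eval A f a = Some y\<close>] in eventually_elim)
        (simp add: justified_prog_code del: prog_code.simps)
  next
    case (Suc k)
    then obtain z where z: "eval A (Prec f g) (prod_encode (a, k)) = Some z"
      "eval A g (prod_encode (a, prod_encode (k, z))) = Some y"
      by (auto simp: bind_eq_Some_conv)
    show ?case
      by (intro eventually_facts, use Suc.IH[OF z(1)] Prec.IH(2)[OF z(2)]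
          eventually_gt_at_top[of z] in eventually_elim)
        (auto simp: justified_prog_code simp del: prog_code.simps)
  qed
next
  case (Mu f)
  have ex: "\<exists>k. eval A f (prod_encode (x, k)) = Some 0 \<and>
      (\<forall>j<k. eval A f (prod_encode (x, j)) \<noteq> None)"
    and y_def: "y = (LEAST k. eval A f (prod_encode (x, k)) = Some 0)"
    using Mu.prems by (auto split: if_splits)
  have y: "eval A f (prod_encode (x, y)) = Some 0"
    unfolding y_def using ex by (metis (mono_tags, lifting) LeastI_ex)
  have below: "\<exists>z. z \<noteq> 0 \<and> eval A f (prod_encode (x, j)) = Some z" if j: "j < y" for j
  proof -
    have "eval A f (prod_encode (x, j)) \<noteq> Some 0" using j not_less_Least unfolding y_def by blast
    moreover have "eval A f (prod_encode (x, j)) \<noteq> None"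
      using ex j unfolding y_def by (metis (mono_tags, lifting) Least_le less_le_trans)
    ultimately show ?thesis by auto
  qed
  have "\<forall>\<^sub>F n in sequentially. \<exists>z<n. z \<noteq> 0 \<and>
      prod_encode (prog_code f, prod_encode (prod_encode (x, j), z)) \<in> facts A n"
    if j: "j \<in> {..<y}" for j
  proof -
    obtain z where z: "z \<noteq> 0" "eval A f (prod_encode (x, j)) = Some z" using below j by blast
    show ?thesis
      using Mu.IH[OF z(2)] eventually_gt_at_top[of z] by eventually_elim (use z(1) in auto)
  qed
  then have all: "\<forall>\<^sub>F n in sequentially. \<forall>j\<in>{..<y}. \<exists>z<n. z \<noteq> 0 \<and>
      prod_encode (prog_code f, prod_encode (prod_encode (x, j), z)) \<in> facts A n"
    by (intro eventually_ball_finite) auto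
  show ?case
    by (intro eventually_facts, use Mu.IH[OF y] all in eventually_elim)
      (simp add: justified_prog_code del: prog_code.simps)
qed (intro eventually_facts always_eventually,
    simp add: justified_prog_code del: prog_code.simps)+

lemma jump_iff_halts: "jump A e \<longleftrightarrow> (\<exists>n. halts A n e)"
proof
  assume "jump A e"
  then obtain c y where "prog_code c = e" "eval A c e = Some y" unfolding jump_def by auto
  then have "\<forall>\<^sub>F n in sequentially. prod_encode (e, prod_encode (e, y)) \<in> facts A n \<and> y < n"
    using facts_complete[of A c e y] eventually_gt_at_top[of y] by (intro eventually_conj) auto
  then show "\<exists>n. halts A n e" unfolding halts_def eventually_sequentially by blast
next
  assume "\<exists>n. halts A n e"
  then show "jump A e"
    using facts_sound prog_code_surj[of e] unfolding halts_def jump_def by fastforce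
qed

text \<open>The oracle \<open>B (p z)\<close> may depend on a parameter that is itself computed from the input. This
  uniformity is what later allows programs to run with an approximated jump as oracle.\<close>

lemma decidable_in_justified:
  assumes B: "decidable_in A (\<lambda>z. B (pfst z) (psnd z))"
    and args: "computable_in A p" "computable_in A n" "computable_in A w"
      "computable_in A c" "computable_in A x" "computable_in A y"
  shows "decidable_in A (\<lambda>z. justified (B (p z)) (n z) (set_decode (w z)) (c z) (x z) (y z))"
proof -
  have B': "decidable_in A (\<lambda>z. B (f z) (g z))" if "computable_in A f" "computable_in A g" for f g
    using computable_in_comp[OF B, of "\<lambda>z. prod_encode (f z, g z)"] that
    by (simp add: computable_intros)
  show ?thesis
    unfolding justified_def Let_def
    by (intro decidable_in_if; intro computable_intros B' args[THEN computable_in_comp])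
qed

text \<open>The finite sets of facts as bit masks, computed by primitive recursion on the number of
  rounds.\<close>

lemma set_encode_facts:
  "set_encode (facts A n) =
     rec_nat 0 (\<lambda>k w. \<Sum>t<Suc k.
       of_bool (justified A k (set_decode w) (pfst t) (pfst (psnd t)) (psnd (psnd t))) * 2 ^ t) n"
proof (induction n)
  case (Suc n)
  define J where "J t = justified A n (facts A n) (pfst t) (pfst (psnd t)) (psnd (psnd t))" for t
  have "finite (facts A n)" using facts_less by (meson bounded_nat_set_is_finite)
  then have IH: "set_decode (rec_nat 0 (\<lambda>k w. \<Sum>t<Suc k.
       of_bool (justified A k (set_decode w) (pfst t) (pfst (psnd t)) (psnd (psnd t))) * 2 ^ t) n)
     = facts A n"
    using Suc set_encode_inverse by metis
  have "set_encode (facts A (Suc n)) = (\<Sum>t\<in>{t \<in> {..<Suc n}. J t}. 2 ^ t)"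
    by (simp add: set_encode_def J_def)
  also have "\<dots> = (\<Sum>t<Suc n. if J t then 2 ^ t else 0)" by (rule sum.inter_filter) simp
  also have "\<dots> = (\<Sum>t<Suc n. of_bool (J t) * 2 ^ t)" by (intro sum.cong) auto
  finally show ?case unfolding nat.rec(2) IH J_def .
qed (simp add: set_encode_def)

lemma decidable_in_halts:
  assumes B: "decidable_in A (\<lambda>z. B (pfst z) (psnd z))"
    and args: "computable_in A p" "computable_in A n" "computable_in A e"
  shows "decidable_in A (\<lambda>x. halts (B (p x)) (n x) (e x))"
proof -
  have table: "computable_in A (\<lambda>x. set_encode (facts (B (f x)) (g x)))"
    if "computable_in A f" "computable_in A g" for f g
    unfolding set_encode_facts
    by (intro computable_intros decidable_in_justified[where B = B, OF B] that[THEN computable_in_comp])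
  \<comment> \<open>Every question about a fact becomes a question about a bit of the table.\<close>
  have "t \<in> facts A' m \<longleftrightarrow> t \<in> set_decode (set_encode (facts A' m))" for t A' m
    using facts_less by (metis bounded_nat_set_is_finite set_encode_inverse)
  then show ?thesis
    unfolding halts_def
    by (simp only:) (intro computable_intros table args args[THEN computable_in_comp])
qed

section \<open>Domination and highness\<close>

text \<open>The code of a program with the constant value \<open>n\<close>. Being computable in \<open>n\<close>, it serves to
  hard-wire an argument into a program.\<close>

primrec const_code :: "nat \<Rightarrow> nat" where
  "const_code 0 = 0"
| "const_code (Suc n) = 6 + 4 * prod_encode (1, const_code n)"

lemma const_code_program:
  obtains k where "prog_code k = const_code n" "\<And>A x. eval A k x = Some n"
proof -
  have "\<exists>k. prog_code k = const_code n \<and> (\<forall>A x. eval A k x = Some n)"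
  proof (induction n)
    case 0
    show ?case by (rule exI[of _ Zero]) simp
  next
    case (Suc n)
    then obtain k where "prog_code k = const_code n" "\<forall>A x. eval A k x = Some n" by blast
    then show ?case by (intro exI[of _ "Comp Succ k"]) simp
  qed
  then show thesis using that by blast
qed

lemma computable_in_const_code: "computable_in A const_code"
proof -
  have eq: "const_code n = rec_nat 0 (\<lambda>_ r. 6 + 4 * prod_encode (1, r)) n" for n
    by (induction n) auto
  have "computable_in A (\<lambda>n. rec_nat 0 (\<lambda>_ r. 6 + 4 * prod_encode (1, r)) n)"
    by (intro computable_intros)
  then show ?thesis unfolding eq[abs_def] .
qed

text \<open>The jump is \<open>\<Sigma>\<^sub>1\<close>-complete, uniformly: composing a search program for \<open>P\<close> with the constant
  program \<open>x\<close> gives a program that ignores its input, and hence the diagonal question about it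
  is the question about \<open>x\<close>. The reduction only manipulates codes, so it is computable without
  any oracle.\<close>

lemma reduces_to_jump:
  assumes "decidable_in A (\<lambda>z. P (pfst z) (psnd z))"
  obtains t where "\<And>B. computable_in B t" "\<And>x. jump A (t x) \<longleftrightarrow> (\<exists>k. P x k)"
proof -
  obtain c where c: "\<And>x. eval A c x \<noteq> None \<longleftrightarrow> (\<exists>k. P x k)"
    using halting_program[of A P] assms by blast
  define t where "t x = 6 + 4 * prod_encode (prog_code c, const_code x)" for x
  have "computable_in B t" for B
    unfolding t_def
    by (intro computable_intros computable_in_const_code[THEN computable_in_comp])
  moreover have "jump A (t x) \<longleftrightarrow> (\<exists>k. P x k)" for x
  proof -
    obtain k where k: "prog_code k = const_code x" "\<And>A y. eval A k y = Some x"
      using const_code_program by blast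
    have "t x = prog_code (Comp c k)" by (simp add: t_def k)
    then have "jump A (t x) \<longleftrightarrow> eval A (Comp c k) (t x) \<noteq> None"
      unfolding jump_def using prog_code_inject by metis
    then show ?thesis by (simp only: eval.simps k(2) Option.bind.simps c)
  qed
  ultimately show thesis by (rule that)
qed

text \<open>The approximations to the jump converge pointwise, and a run of \<open>n\<close> rounds consults finitely
  many positions only.\<close>

lemma eventually_halts_approx:
  "\<forall>\<^sub>F s in sequentially. halts (halts A s) n = halts (jump A) n"
proof -
  have "\<forall>\<^sub>F s in sequentially. halts A s k = jump A k" for k
  proof (cases "jump A k")
    case True
    then obtain s0 where "halts A s0 k" unfolding jump_iff_halts by blast
    then have "halts A s k" if "s \<ge> s0" for s using halts_mono that by blast
    then show ?thesis using True unfolding eventually_sequentially by blast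
  next
    case False
    then show ?thesis unfolding jump_iff_halts by simp
  qed
  then have "\<forall>\<^sub>F s in sequentially. \<forall>k\<in>{..<n}. halts A s k = jump A k"
    by (intro eventually_ball_finite) auto
  then show ?thesis by eventually_elim (rule halts_use, simp)
qed

text \<open>The second jump is \<open>\<Sigma>\<^sub>2\<close>. One number \<open>n\<close> bounds both the length of the computation and the
  stage from which the approximated oracle is correct on it; more rounds do no harm, as
  \<open>halts\<close> is monotone in them.\<close>

lemma jump_jump_iff:
  "jump (jump A) e \<longleftrightarrow> (\<exists>n. \<forall>s\<ge>n. halts (halts A s) n e)"
proof
  assume "jump (jump A) e"
  then obtain m where m: "halts (jump A) m e" unfolding jump_iff_halts by blast
  obtain s0 where s0: "\<And>s. s \<ge> s0 \<Longrightarrow> halts (halts A s) m = halts (jump A) m"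
    using eventually_halts_approx unfolding eventually_sequentially by blast
  have "halts (halts A s) (max m s0) e" if s: "s \<ge> max m s0" for s
  proof (rule halts_mono)
    show "halts (halts A s) m e" using m s s0 by simp
  qed simp
  then show "\<exists>n. \<forall>s\<ge>n. halts (halts A s) n e" by blast
next
  assume "\<exists>n. \<forall>s\<ge>n. halts (halts A s) n e"
  then obtain n where "\<forall>s\<ge>n. halts (halts A s) n e" by blast
  then have "\<forall>\<^sub>F s in sequentially. halts (halts A s) n e"
    unfolding eventually_sequentially by blast
  then have "\<forall>\<^sub>F s in sequentially. halts (jump A) n e"
    using eventually_halts_approx[of A n] by eventually_elim simp
  then show "jump (jump A) e" unfolding jump_iff_halts by auto
qed

lemma decidable_in_nested_halts:
  assumes "computable_in A s" "computable_in A n" "computable_in A e"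
  shows "decidable_in A (\<lambda>x. halts (halts empty_seq (s x)) (n x) (e x))"
proof -
  have "decidable_in A (\<lambda>z. halts empty_seq (pfst z) (psnd z))"
    by (rule decidable_in_halts[where B = "\<lambda>_. empty_seq" and p = "\<lambda>_. 0"])
      (auto simp: empty_seq_def intro!: computable_intros)
  then show ?thesis using assms by (rule decidable_in_halts[where B = "halts empty_seq"])
qed

text \<open>The direction of Martin's characterisation of highness that starts from a dominating
  function. In the proof, \<open>P \<langle>e, m\<rangle>\<close> searches for a counterexample to \<open>\<forall>s\<ge>m. H e m s\<close>, that is,
  to \<open>m\<close> witnessing membership of \<open>e\<close> in the second jump. Its counterpart \<open>Q \<langle>e, m\<rangle>\<close> searches
  for a counterexample to \<open>m\<close> witnessing non-membership: an \<open>n \<ge> m\<close> such that \<open>H e n\<close>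
  is not refuted by any stage from \<open>n\<close> to \<open>g n\<close>. For every \<open>e\<close>, exactly one of the two kinds of
  witness exists. The jump of \<open>X\<close> knows which searches fail, so it finds a witness.\<close>

lemma high_if_dominating:
  assumes g: "computable_in X g"
    and dom: "\<And>f. computable f \<Longrightarrow> \<forall>\<^sub>F n in sequentially. f n \<le> g n"
  shows "high X"
proof -
  define H where "H e n s \<longleftrightarrow> halts (halts empty_seq s) n e" for e n s
  have H_mono: "H e m s" if "H e n s" "n \<le> m" for e n m s
    using that halts_mono unfolding H_def by blast
  have H_dec: "decidable_in A (\<lambda>x. H (e x) (n x) (s x))"
    if "computable_in A e" "computable_in A n" "computable_in A s" for A e n s
    unfolding H_def using that(3,2,1) by (rule decidable_in_nested_halts)

  define P where "P v s \<longleftrightarrow> psnd v \<le> s \<and> \<not> H (pfst v) (psnd v) s" for v s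
  define Q where "Q v n \<longleftrightarrow> psnd v \<le> n \<and> \<not> (\<exists>s<Suc (g n). n \<le> s \<and> \<not> H (pfst v) n s)" for v n
  have P_dec: "decidable_in X (\<lambda>z. P (pfst z) (psnd z))"
    unfolding P_def by (intro computable_intros H_dec)
  have Q_dec: "decidable_in X (\<lambda>z. Q (pfst z) (psnd z))"
    unfolding Q_def by (intro computable_intros H_dec g[THEN computable_in_comp])
  obtain p where p: "\<And>B. computable_in B p" "\<And>x. jump X (p x) \<longleftrightarrow> (\<exists>k. P x k)"
    using reduces_to_jump[of X P] P_dec by blast
  obtain q where q: "\<And>B. computable_in B q" "\<And>x. jump X (q x) \<longleftrightarrow> (\<exists>k. Q x k)"
    using reduces_to_jump[of X Q] Q_dec by blast

  have in_iff: "jump (jump empty_seq) e \<longleftrightarrow> (\<exists>m. \<not> jump X (p (prod_encode (e, m))))" for e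
    unfolding jump_jump_iff p(2) P_def H_def by auto
  have notin_if: "\<not> jump (jump empty_seq) e" if "\<not> jump X (q (prod_encode (e, m)))" for e m
  proof
    assume "jump (jump empty_seq) e"
    then obtain n where n: "\<And>s. s \<ge> n \<Longrightarrow> H e n s" unfolding jump_jump_iff H_def by blast
    \<comment> \<open>A membership witness stays one when it is enlarged, so both witnesses speak about
      \<open>max n m\<close>.\<close>
    have "\<not> Q (prod_encode (e, m)) (max n m)" using that unfolding q(2) by blast
    then obtain s where "max n m \<le> s" "\<not> H e (max n m) s" unfolding Q_def by auto
    then show False using n H_mono by (metis max.bounded_iff max.cobounded1)
  qed
  have notin_only_if: "\<exists>m. \<not> jump X (q (prod_encode (e, m)))" if "\<not> jump (jump empty_seq) e" for e
  proof -
    have ex: "\<exists>s. n \<le> s \<and> \<not> H e n s" for n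
      using that unfolding jump_jump_iff H_def by blast
    define f where "f n = (LEAST s. n \<le> s \<and> \<not> H e n s)" for n
    have f: "n \<le> f n \<and> \<not> H e n (f n)" for n
      unfolding f_def by (rule LeastI_ex[OF ex])
    have "computable f"
      unfolding computable_def f_def[abs_def] by (intro computable_intros H_dec ex)
    then obtain m where m: "\<And>n. n \<ge> m \<Longrightarrow> f n \<le> g n"
      using dom unfolding eventually_sequentially by blast
    have "\<not> Q (prod_encode (e, m)) n" for n
      using f[of n] m[of n] unfolding Q_def by (auto simp: less_Suc_eq_le)
    then show ?thesis unfolding q(2) by blast
  qed

  define search where
    "search e = (LEAST m. \<not> jump X (p (prod_encode (e, m))) \<or> \<not> jump X (q (prod_encode (e, m))))" for e
  have ex: "\<exists>m. \<not> jump X (p (prod_encode (e, m))) \<or> \<not> jump X (q (prod_encode (e, m)))" for e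
    using in_iff notin_only_if by blast
  have found: "\<not> jump X (p (prod_encode (e, search e))) \<or> \<not> jump X (q (prod_encode (e, search e)))" for e
    unfolding search_def by (rule LeastI_ex[OF ex])
  have "jump (jump empty_seq) e \<longleftrightarrow> \<not> jump X (p (prod_encode (e, search e)))" for e
    using found[of e] in_iff notin_if by blast
  moreover have "decidable_in (jump X) (\<lambda>e. \<not> jump X (p (prod_encode (e, search e))))"
    unfolding search_def
    by (intro computable_intros decidable_in_oracle p(1)[THEN computable_in_comp]
        q(1)[THEN computable_in_comp] ex)
  ultimately show ?thesis unfolding high_def turing_le_def by simp
qed

section \<open>Strings and approximations as numbers\<close>

text \<open>The least significant digit of a string code comes first, so appending a string adds a
  shifted code.\<close>

lemma str_code_append: "str_code (\<sigma> @ \<tau>) = str_code \<sigma> + 2 ^ length \<sigma> * str_code \<tau>"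
  by (induction \<sigma>) (auto simp: algebra_simps)

lemma length_init_seg [simp]: "length (init_seg X n) = n"
  by (simp add: init_seg_def)

lemma init_seg_Suc: "init_seg X (Suc n) = init_seg X n @ [X n]"
  by (simp add: init_seg_def)

lemma take_init_seg: "m \<le> n \<Longrightarrow> take m (init_seg X n) = init_seg X m"
  by (simp add: init_seg_def take_map)

lemma str_code_init_seg:
  "str_code (init_seg X n) = rec_nat 0 (\<lambda>m r. r + 2 ^ m * Suc (of_bool (X m))) n"
  by (induction n) (auto simp: init_seg_Suc str_code_append, simp add: init_seg_def)

lemma computable_in_init_seg: "computable_in X (\<lambda>n. str_code (init_seg X n))"
  unfolding str_code_init_seg by (intro computable_intros decidable_in_oracle)

text \<open>The codes of the strings of length \<open>l\<close> are the numbers \<open>t\<close> with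
  \<open>2 ^ l \<le> t + 1 < 2 ^ (l + 1)\<close>.\<close>

definition code_length :: "nat \<Rightarrow> nat" where
  "code_length t = (\<Sum>k<t. of_bool (2 ^ Suc k \<le> Suc t))"

lemma computable_in_code_length: "computable_in A code_length"
  unfolding code_length_def by (intro computable_intros)

lemma code_length_str_code [simp]: "code_length (str_code \<sigma>) = length \<sigma>"
proof -
  have lower: "2 ^ length \<sigma> \<le> Suc (str_code \<sigma>)" and upper: "Suc (str_code \<sigma>) < 2 ^ Suc (length \<sigma>)"
    by (induction \<sigma>) auto
  have "k < str_code \<sigma> \<and> 2 ^ Suc k \<le> Suc (str_code \<sigma>) \<longleftrightarrow> k < length \<sigma>" for k
  proof
    assume "k < str_code \<sigma> \<and> 2 ^ Suc k \<le> Suc (str_code \<sigma>)"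
    then have "(2::nat) ^ Suc k < 2 ^ Suc (length \<sigma>)" using upper by linarith
    then show "k < length \<sigma>" by simp
  next
    assume k: "k < length \<sigma>"
    then have "(2::nat) ^ Suc k \<le> 2 ^ length \<sigma>" by (intro power_increasing) auto
    then have "2 ^ Suc k \<le> Suc (str_code \<sigma>)" using lower by linarith
    moreover have "k < str_code \<sigma>"
      using k lower less_exp[of "length \<sigma>"] by linarith
    ultimately show "k < str_code \<sigma> \<and> 2 ^ Suc k \<le> Suc (str_code \<sigma>)" by simp
  qed
  then have "{..<str_code \<sigma>} \<inter> {k. 2 ^ Suc k \<le> Suc (str_code \<sigma>)} = {..<length \<sigma>}" by auto
  then have "(\<Sum>k<str_code \<sigma>. of_bool (2 ^ Suc k \<le> Suc (str_code \<sigma>))) = card {..<length \<sigma>}"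
    by (simp del: power_Suc)
  then show ?thesis unfolding code_length_def by simp
qed

text \<open>Every number is a string code, so the remainder \<open>r\<close> ranges over all possible rests of the
  string; the bound on \<open>r\<close> makes the relation decidable.\<close>

lemma prefix_iff_str_code:
  "prefix \<sigma> \<tau> \<longleftrightarrow>
    (\<exists>r<Suc (str_code \<tau>). str_code \<tau> = str_code \<sigma> + 2 ^ code_length (str_code \<sigma>) * r)"
proof
  assume "prefix \<sigma> \<tau>"
  then obtain \<rho> where "\<tau> = \<sigma> @ \<rho>" by (auto elim: prefixE)
  then have eq: "str_code \<tau> = str_code \<sigma> + 2 ^ length \<sigma> * str_code \<rho>" by (simp add: str_code_append)
  have "str_code \<rho> \<le> 2 ^ length \<sigma> * str_code \<rho>" by simp
  then have "str_code \<rho> < Suc (str_code \<tau>)" using eq by linarith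
  then show "\<exists>r<Suc (str_code \<tau>). str_code \<tau> = str_code \<sigma> + 2 ^ code_length (str_code \<sigma>) * r"
    using eq by auto
next
  assume "\<exists>r<Suc (str_code \<tau>). str_code \<tau> = str_code \<sigma> + 2 ^ code_length (str_code \<sigma>) * r"
  then obtain r where "str_code \<tau> = str_code \<sigma> + 2 ^ length \<sigma> * r" by auto
  moreover obtain \<rho> where "str_code \<rho> = r" using str_code_surj by blast
  ultimately have "\<tau> = \<sigma> @ \<rho>" by (intro str_code_inject) (simp add: str_code_append)
  then show "prefix \<sigma> \<tau>" by simp
qed

text \<open>The odd codes are those of the negative integers.\<close>

lemma rat_decode_less_power:
  "(of_rat (rat_decode r) :: real) < (1/2) ^ k \<longleftrightarrow>
     odd (pfst r) \<or> pfst r div 2 * 2 ^ k < Suc (psnd r)"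
proof -
  have "(of_rat (rat_decode r) :: real) = of_int (int_decode (pfst r)) / real (Suc (psnd r))"
    unfolding rat_decode_def by (simp add: of_rat_divide del: of_nat_Suc)
  also have "\<dots> < (1/2) ^ k \<longleftrightarrow>
      real_of_int (int_decode (pfst r)) * 2 ^ k < real (Suc (psnd r))"
    by (simp add: divide_simps del: of_nat_Suc)
  also have "\<dots> \<longleftrightarrow> odd (pfst r) \<or> pfst r div 2 * 2 ^ k < Suc (psnd r)"
  proof (cases "odd (pfst r)")
    case True
    then have "int_decode (pfst r) < 0" by (simp add: int_decode_def sum_decode_def)
    then have "real_of_int (int_decode (pfst r)) * 2 ^ k < 0" by (simp add: mult_neg_pos)
    then show ?thesis using True by (smt (verit) of_nat_0_le_iff)
  next
    case False
    then have "int_decode (pfst r) = int (pfst r div 2)"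
      by (simp add: int_decode_def sum_decode_def)
    then have "real_of_int (int_decode (pfst r)) * 2 ^ k = real (pfst r div 2 * 2 ^ k)" by simp
    then show ?thesis using False by (simp only: of_nat_less_iff) simp
  qed
  finally show ?thesis .
qed

definition approximates :: "(nat \<Rightarrow> nat) \<Rightarrow> (bool list \<Rightarrow> real) \<Rightarrow> bool" where
  "approximates q F \<longleftrightarrow>
     (\<forall>\<sigma> n. \<bar>F \<sigma> - of_rat (rat_decode (q (prod_encode (str_code \<sigma>, n))))\<bar> \<le> (1/2) ^ n)"

text \<open>Comparing a real with \<open>2 ^ -k\<close> is undecidable, but comparing its approximation of precision
  \<open>2 ^ -(k + 1)\<close> is not; the answer is reliable up to a factor of \<open>2\<close> on either side, as the next
  two lemmas say.\<close>

definition tiny :: "(nat \<Rightarrow> nat) \<Rightarrow> nat \<Rightarrow> nat \<Rightarrow> bool" where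
  "tiny q k s \<longleftrightarrow> (of_rat (rat_decode (q (prod_encode (s, Suc k)))) :: real) < (1/2) ^ k"

lemma tiny_if:
  assumes "approximates q F" "F \<sigma> < (1/2) ^ Suc k"
  shows "tiny q k (str_code \<sigma>)"
proof -
  have "\<bar>F \<sigma> - of_rat (rat_decode (q (prod_encode (str_code \<sigma>, Suc k))))\<bar> \<le> (1/2) ^ Suc k"
    using assms(1) unfolding approximates_def by blast
  then show ?thesis using assms(2) unfolding tiny_def power_Suc by linarith
qed

lemma tiny_bound:
  assumes "approximates q F" "tiny q k (str_code \<sigma>)"
  shows "F \<sigma> < 2 * (1/2) ^ k"
proof -
  have "\<bar>F \<sigma> - of_rat (rat_decode (q (prod_encode (str_code \<sigma>, Suc k))))\<bar> \<le> (1/2) ^ Suc k"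
    using assms(1) unfolding approximates_def by blast
  moreover have "(0::real) < (1/2) ^ k" by simp
  ultimately show ?thesis using assms(2) unfolding tiny_def power_Suc by linarith
qed

lemma decidable_in_tiny:
  assumes "computable_in A q" "computable_in A k" "computable_in A s"
  shows "decidable_in A (\<lambda>x. tiny q (k x) (s x))"
  unfolding tiny_def rat_decode_less_power
  by (intro computable_intros assms assms(1)[THEN computable_in_comp])

section \<open>Paths of positive mass are computable\<close>

lemma decidable_in_finite:
  assumes "finite S" shows "decidable_in A (\<lambda>x. x \<in> S)"
  using assms
proof (induction S rule: finite_induct)
  case empty
  show ?case unfolding empty_iff by (rule computable_intros)
next
  case (insert a S)
  show ?case unfolding insert_iff by (intro computable_intros insert.IH)
qed

text \<open>The masses \<open>F (X|n)\<close> decrease to a limit \<open>\<ge> 2 ^ -k\<close>. Once they are within \<open>2 ^ -(k + 2)\<close> of each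
  other, that is all the mass left for a string leaving \<open>X\<close>, whereas the extension along \<open>X\<close>
  keeps \<open>2 ^ -k\<close>. The gap is wide enough for the test \<open>tiny q (k + 1)\<close> to tell the two
  apart.\<close>

lemma computable_if_not_null:
  assumes q: "computable q" "approximates q F"
    and add: "\<And>\<sigma>. F \<sigma> = F (\<sigma> @ [True]) + F (\<sigma> @ [False])"
    and nonneg: "\<And>\<sigma>. 0 \<le> F \<sigma>"
    and mass: "\<And>n. (1/2) ^ k \<le> F (init_seg X n)"
  shows "computable_seq X"
proof -
  define a where "a n = F (init_seg X n)" for n
  have "a (Suc n) \<le> a n" for n
    using add[of "init_seg X n"] nonneg[of "init_seg X n @ [\<not> X n]"]
    unfolding a_def init_seg_Suc by (cases "X n") auto
  then have "decseq a" by (rule decseq_SucI)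
  then obtain L where "a \<longlonglongrightarrow> L"
    using decseq_convergent[of a 0] nonneg unfolding a_def by blast
  then have "convergent a" by (rule convergentI)
  then obtain m0 where m0: "\<And>m n. m \<ge> m0 \<Longrightarrow> n \<ge> m0 \<Longrightarrow> norm (a m - a n) < (1/2) ^ Suc (Suc k)"
    using CauchyD[OF convergent_Cauchy, of a "(1/2) ^ Suc (Suc k)"] by auto
  have X_iff: "X n \<longleftrightarrow> \<not> tiny q (Suc k) (str_code (init_seg X n @ [True]))" if n: "n \<ge> m0" for n
  proof (cases "X n")
    case True
    then have "2 * (1/2) ^ Suc k \<le> F (init_seg X n @ [True])"
      using mass[of "Suc n"] by (simp add: init_seg_Suc)
    then show ?thesis using True tiny_bound[OF q(2)] by force
  next
    case False
    then have "F (init_seg X n @ [True]) = a n - a (Suc n)"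
      using add[of "init_seg X n"] by (simp add: a_def init_seg_Suc)
    then have "F (init_seg X n @ [True]) < (1/2) ^ Suc (Suc k)"
      using m0[of n "Suc n"] n unfolding real_norm_def by linarith
    then show ?thesis using False tiny_if[OF q(2)] by blast
  qed
  \<comment> \<open>The first \<open>m0\<close> bits form a finite table; the later ones are found recursively, by testing
    whether appending the bit 1 (digit 2, hence the summand \<open>2 ^ n * 2\<close>) yields a tiny mass.\<close>
  define S where "S = {n. n < m0 \<and> X n}"
  define b where "b n s \<longleftrightarrow> n \<in> S \<or> m0 \<le> n \<and> \<not> tiny q (Suc k) (s + 2 ^ n * 2)" for n s
  have b: "b n (str_code (init_seg X n)) \<longleftrightarrow> X n" for n
    using X_iff[of n] unfolding b_def S_def by (cases "m0 \<le> n") (auto simp: str_code_append mult_2_right)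
  define z where "z n = rec_nat 0 (\<lambda>m r. r + 2 ^ m * Suc (of_bool (b m r))) n" for n
  have z: "z n = str_code (init_seg X n)" for n
  proof (induction n)
    case (Suc n)
    then show ?case unfolding z_def by (simp add: b init_seg_Suc str_code_append)
  qed (simp add: z_def init_seg_def)
  have "finite S" unfolding S_def by simp
  have b_dec: "decidable_in empty_seq (\<lambda>x. b (f x) (g x))"
    if "computable_in empty_seq f" "computable_in empty_seq g" for f g
    unfolding b_def using q(1)[unfolded computable_def] that
    by (intro computable_intros decidable_in_tiny decidable_in_finite[OF \<open>finite S\<close>, THEN computable_in_comp])
  have "decidable_in empty_seq (\<lambda>n. b n (z n))"
    unfolding z_def by (intro computable_intros b_dec)
  then show ?thesis unfolding computable_seq_def computable_def z b .
qed

section \<open>Complexity and measure along a random sequence\<close>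

text \<open>By induction on the maximal length: unless the empty string is the only member, the set
  splits by first bits into two prefix-free sets of shorter strings, each weighted by
  one half.\<close>

lemma kraft_inequality:
  fixes S :: "bool list set"
  assumes "finite S" "\<And>p q. p \<in> S \<Longrightarrow> q \<in> S \<Longrightarrow> prefix p q \<Longrightarrow> p = q"
  shows "(\<Sum>p\<in>S. (1/2 :: real) ^ length p) \<le> 1"
proof -
  obtain N where "\<And>p. p \<in> S \<Longrightarrow> length p \<le> N"
    using finite_nat_set_iff_bounded_le[of "length ` S"] assms(1) by auto
  then show ?thesis
    using assms
  proof (induction N arbitrary: S)
    case 0
    have "S \<subseteq> {[]}" using "0.prems"(1) by auto
    then have "S = {} \<or> S = {[]}" by blast
    then show ?case by auto
  next
    case (Suc N)
    show ?case
    proof (cases "[] \<in> S")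
      case True
      then have "S = {[]}" using Suc.prems(3)[OF True] by auto
      then show ?thesis by simp
    next
      case False
      define T where "T b = {p. b # p \<in> S}" for b
      have S: "S = Cons True ` T True \<union> Cons False ` T False"
      proof (intro set_eqI iffI)
        fix p assume "p \<in> S"
        then show "p \<in> Cons True ` T True \<union> Cons False ` T False"
          using False by (cases p; cases "hd p") (auto simp: T_def)
      qed (auto simp: T_def)
      have fin: "finite (T b)" for b
        using finite_vimageI[OF Suc.prems(2), of "Cons b"] by (simp add: T_def vimage_def)
      have half: "(\<Sum>p\<in>Cons b ` T b. (1/2 :: real) ^ length p) \<le> 1/2" for b
      proof -
        have "(\<Sum>p\<in>Cons b ` T b. (1/2 :: real) ^ length p)
            = (\<Sum>p\<in>T b. (1/2) * (1/2) ^ length p)"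
          by (subst sum.reindex) auto
        also have "\<dots> = (1/2) * (\<Sum>p\<in>T b. (1/2) ^ length p)" by (simp only: sum_distrib_left)
        also have "(\<Sum>p\<in>T b. (1/2 :: real) ^ length p) \<le> 1"
          using Suc.prems fin by (intro Suc.IH) (fastforce simp: T_def)+
        finally show ?thesis by simp
      qed
      have "(\<Sum>p\<in>S. (1/2 :: real) ^ length p) =
          (\<Sum>p\<in>Cons True ` T True. (1/2) ^ length p) + (\<Sum>p\<in>Cons False ` T False. (1/2) ^ length p)"
        unfolding S using fin by (intro sum.union_disjoint) auto
      then show ?thesis using half[of True] half[of False] by linarith
    qed
  qed
qed

lemma cylinder_append: "cylinder (\<sigma> @ [b]) = {X \<in> cylinder \<sigma>. X (length \<sigma>) = b}"
  by (auto simp: cylinder_def init_seg_Suc)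

lemma cylinder_antimono: "prefix \<sigma> \<tau> \<Longrightarrow> cylinder \<tau> \<subseteq> cylinder \<sigma>"
  by (auto simp: cylinder_def elim!: prefixE)
    (metis append_eq_conv_conj le_add1 take_init_seg)

lemma mem_cylinder_init_seg: "X \<in> cylinder (init_seg X n)"
  by (simp add: cylinder_def)

lemma open_cylinder: "open (cylinder \<sigma>)"
proof (induction \<sigma> rule: rev_induct)
  case Nil
  then show ?case by (simp add: cylinder_def init_seg_def)
next
  case (snoc b \<sigma>)
  have "open ((\<lambda>X :: nat \<Rightarrow> bool. X (length \<sigma>)) -` {b})"
    by (rule open_vimage[OF _ continuous_on_product_coordinates]) (rule discrete_topology_class.open_discrete)
  then have "open (cylinder \<sigma> \<inter> (\<lambda>X :: nat \<Rightarrow> bool. X (length \<sigma>)) -` {b})"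
    using snoc.IH by blast
  moreover have "cylinder (\<sigma> @ [b]) = cylinder \<sigma> \<inter> (\<lambda>X. X (length \<sigma>)) -` {b}"
    by (auto simp: cylinder_append)
  ultimately show ?case by simp
qed

lemma cylinder_in_sets: "borel_prob \<mu> \<Longrightarrow> cylinder \<sigma> \<in> sets \<mu>"
  using open_cylinder by (simp add: borel_prob_def)

lemma measure_cylinder_split:
  assumes "borel_prob \<mu>"
  shows "measure \<mu> (cylinder \<sigma>) = measure \<mu> (cylinder (\<sigma> @ [True])) + measure \<mu> (cylinder (\<sigma> @ [False]))"
proof -
  interpret prob_space \<mu> using assms by (simp add: borel_prob_def)
  have "cylinder \<sigma> = cylinder (\<sigma> @ [True]) \<union> cylinder (\<sigma> @ [False])"
    by (auto simp: cylinder_append)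
  moreover have "cylinder (\<sigma> @ [True]) \<inter> cylinder (\<sigma> @ [False]) = {}"
    by (auto simp: cylinder_append)
  ultimately show ?thesis
    using finite_measure_Union cylinder_in_sets[OF assms] by metis
qed

text \<open>Summing the bound \<open>2 ^ -(length p + i)\<close> over programs \<open>p\<close> gives at most \<open>2 ^ -i\<close> by Kraft's
  inequality, which passes from finite to infinite sets of programs since it bounds all
  partial sums.\<close>

lemma measure_compressible_le:
  fixes U :: "bool list \<Rightarrow> bool list option" and P :: "bool list set"
  assumes \<mu>: "borel_prob \<mu>"
    and pf: "\<And>p q. p \<in> dom U \<Longrightarrow> q \<in> dom U \<Longrightarrow> prefix p q \<Longrightarrow> p = q"
    and bound: "\<And>p \<sigma>. p \<in> P \<Longrightarrow> U p = Some \<sigma> \<Longrightarrow> measure \<mu> (cylinder \<sigma>) \<le> (1/2) ^ (length p + i)"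
    and P: "P \<subseteq> dom U"
  shows "measure \<mu> (\<Union>p\<in>P. cylinder (the (U p))) \<le> (1/2) ^ i"
proof -
  interpret prob_space \<mu> using \<mu> by (simp add: borel_prob_def)
  define A where "A n = (if inv str_code n \<in> P then cylinder (the (U (inv str_code n))) else {})" for n
  have inv: "inv str_code (str_code p) = p" for p
    using bij_str_code by (simp add: bij_is_inj)
  have sets: "range A \<subseteq> sets \<mu>" using cylinder_in_sets[OF \<mu>] by (auto simp: A_def)
  have union: "(\<Union>p\<in>P. cylinder (the (U p))) = (\<Union>n. A n)"
  proof (intro equalityI subsetI)
    fix Y assume "Y \<in> (\<Union>p\<in>P. cylinder (the (U p)))"
    then obtain p where "p \<in> P" "Y \<in> cylinder (the (U p))" by blast
    then have "Y \<in> A (str_code p)" by (simp add: A_def inv)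
    then show "Y \<in> (\<Union>n. A n)" by blast
  qed (auto simp: A_def split: if_splits)
  have partial: "(\<Sum>n<N. measure \<mu> (A n)) \<le> (1/2) ^ i" for N
  proof -
    define S where "S = {p \<in> P. str_code p < N}"
    have fin: "finite S"
      using finite_vimageI[of "{..<N}" str_code] bij_is_inj[OF bij_str_code]
      unfolding S_def by (rule_tac finite_subset) auto
    have "(\<Sum>n<N. measure \<mu> (A n)) = (\<Sum>n\<in>str_code ` S. measure \<mu> (A n))"
    proof (rule sum.mono_neutral_right)
      show "\<forall>n\<in>{..<N} - str_code ` S. measure \<mu> (A n) = 0"
      proof
        fix n assume n: "n \<in> {..<N} - str_code ` S"
        have "str_code (inv str_code n) = n" using bij_str_code by (simp add: bij_is_surj surj_f_inv_f)
        moreover have "inv str_code n \<notin> S" using n calculation by (metis DiffD2 imageI)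
        ultimately have "inv str_code n \<notin> P" using n unfolding S_def by auto
        then show "measure \<mu> (A n) = 0" by (simp add: A_def)
      qed
    qed (auto simp: S_def)
    also have "\<dots> = (\<Sum>p\<in>S. measure \<mu> (A (str_code p)))"
      by (rule sum.reindex_cong[OF inj_on_subset[OF bij_is_inj[OF bij_str_code]]]) auto
    also have "\<dots> \<le> (\<Sum>p\<in>S. (1/2) ^ length p * (1/2) ^ i)"
    proof (rule sum_mono)
      fix p assume "p \<in> S"
      then have "p \<in> P" by (simp add: S_def)
      then obtain \<sigma> where "U p = Some \<sigma>" using P by blast
      then show "measure \<mu> (A (str_code p)) \<le> (1/2) ^ length p * (1/2) ^ i"
        using bound[OF \<open>p \<in> P\<close>] \<open>p \<in> P\<close> by (simp add: A_def inv power_add)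
    qed
    also have "\<dots> = (\<Sum>p\<in>S. (1/2) ^ length p) * (1/2) ^ i" by (simp only: sum_distrib_right)
    also have "\<dots> \<le> 1 * (1/2) ^ i"
    proof (intro mult_right_mono kraft_inequality fin)
      show "p = p'" if "p \<in> S" "p' \<in> S" "prefix p p'" for p p'
        using that pf P unfolding S_def by blast
    qed simp
    finally show ?thesis by simp
  qed
  then have summable: "summable (\<lambda>n. measure \<mu> (A n))"
    by (intro summableI_nonneg_bounded) auto
  then have "measure \<mu> (\<Union>n. A n) \<le> (\<Sum>n. measure \<mu> (A n))"
    by (rule finite_measure_subadditive_countably[OF sets])
  also have "\<dots> \<le> (1/2) ^ i" using summable partial by (rule suminf_le_const)
  finally show ?thesis unfolding union .
qed

text \<open>One half of the Levin-Schnorr theorem. The level \<open>V i\<close> of the test consists of cylinders of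
  strings \<open>\<sigma> = U p\<close> of measure at most \<open>2 ^ -(length p + i)\<close>, and contains all those of measure
  below a quarter of this bound. The obvious enumeration would, given
  \<open>\<sigma>\<close>, search through all \<open>p\<close> with dovetailed runs of \<open>U\<close>. Enumerating longer strings instead avoids
  the search: \<open>\<tau>\<close> is admitted if its length encodes some \<open>p\<close> whose output is a prefix of \<open>\<tau>\<close> of
  small measure. Given \<open>\<tau>\<close>, a single run of \<open>U\<close> decides the matter, and as every \<open>p\<close> is encoded
  by infinitely many lengths, no member of the cylinder of \<open>\<sigma>\<close> is missed.\<close>

lemma random_complexity_lower_bound:
  assumes U: "prefix_free_machine U" and \<mu>: "borel_prob \<mu>"
    and q: "computable q" "approximates q (\<lambda>\<sigma>. measure \<mu> (cylinder \<sigma>))"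
    and random: "ml_random \<mu> X"
  shows "\<exists>c. \<forall>p n. U p = Some (init_seg X n) \<longrightarrow>
    (1/2) ^ (length p + c) \<le> measure \<mu> (cylinder (init_seg X n))"
proof -
  define F where "F \<sigma> = measure \<mu> (cylinder \<sigma>)" for \<sigma>
  have q': "approximates q F" using q(2) by (simp add: F_def[abs_def])
  obtain cU where cU: "\<And>\<sigma>. eval empty_seq cU (str_code \<sigma>) = map_option str_code (U \<sigma>)"
    using U unfolding prefix_free_machine_def partial_computable_str_def by blast
  \<comment> \<open>For \<open>z = \<langle>i, \<tau>\<rangle>\<close> and \<open>s\<close> the output of the program encoded by the length of \<open>\<tau>\<close>: \<open>s\<close> is a
    prefix of \<open>\<tau>\<close> and passes a test that bounds its measure by \<open>2 ^ -(length p + i)\<close>.\<close>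
  define D where "D z s \<longleftrightarrow>
      (\<exists>r<Suc (psnd z). psnd z = s + 2 ^ code_length s * r) \<and>
      tiny q (Suc (code_length (pfst (code_length (psnd z))) + pfst z)) s" for z s
  \<comment> \<open>\<open>cD\<close> halts exactly on the pairs satisfying the decidable predicate \<open>D\<close>, after a search over
    a dummy variable.\<close>
  have "decidable_in empty_seq (\<lambda>v. (\<lambda>v _. D (pfst v) (psnd v)) (pfst v) (psnd v))"
    unfolding D_def using q(1)[unfolded computable_def]
    by (intro computable_intros decidable_in_tiny computable_in_code_length[THEN computable_in_comp])
  then obtain cD where cD:
    "\<And>v. eval empty_seq cD v \<noteq> None \<longleftrightarrow> (\<exists>k::nat. D (pfst v) (psnd v))"
    using halting_program[where P = "\<lambda>v _. D (pfst v) (psnd v)"] by blast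
  have "computable_in empty_seq (\<lambda>z. pfst (code_length (psnd z)))"
    by (intro computable_intros computable_in_code_length[THEN computable_in_comp])
  then obtain cp where cp: "\<And>z. eval empty_seq cp z = Some (pfst (code_length (psnd z)))"
    unfolding computable_in_def by blast
  define W where "W = {z. \<exists>s. eval empty_seq cU (pfst (code_length (psnd z))) = Some s \<and> D z s}"
  have "W = {z. eval empty_seq (Comp cD (Pair (Pair Fst Snd) (Comp cU cp))) z \<noteq> None}"
    unfolding W_def
  proof (rule Collect_cong)
    fix z
    show "(\<exists>s. eval empty_seq cU (pfst (code_length (psnd z))) = Some s \<and> D z s) \<longleftrightarrow>
      eval empty_seq (Comp cD (Pair (Pair Fst Snd) (Comp cU cp))) z \<noteq> None"
      using cD by (cases "eval empty_seq cU (pfst (code_length (psnd z)))") (auto simp: cp)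
  qed
  then have ce: "computably_enumerable W" unfolding computably_enumerable_def by blast
  define V where "V i = (\<Union>\<tau>\<in>{\<tau>. prod_encode (i, str_code \<tau>) \<in> W}. cylinder \<tau>)" for i
  have "uniformly_Sigma01 V" unfolding uniformly_Sigma01_def V_def using ce by blast
  have W_iff: "prod_encode (i, str_code \<tau>) \<in> W \<longleftrightarrow>
      (\<exists>p \<sigma>. pfst (length \<tau>) = str_code p \<and> U p = Some \<sigma> \<and> prefix \<sigma> \<tau> \<and>
        tiny q (Suc (length p + i)) (str_code \<sigma>))" for i \<tau>
  proof -
    obtain p where p: "str_code p = pfst (length \<tau>)" using str_code_surj by blast
    then have "pfst (length \<tau>) = str_code p' \<longleftrightarrow> p' = p" for p'
      using str_code_inject by metis
    then show ?thesis
      unfolding W_def D_def by (auto simp: prefix_iff_str_code p[symmetric] cU)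
  qed
  have "measure \<mu> (V i) \<le> (1/2) ^ i" for i
  proof -
    interpret prob_space \<mu> using \<mu> by (simp add: borel_prob_def)
    define P where "P = {p \<in> dom U. F (the (U p)) \<le> (1/2) ^ (length p + i)}"
    have "V i \<subseteq> (\<Union>p\<in>P. cylinder (the (U p)))"
    proof
      fix Y assume "Y \<in> V i"
      then obtain \<tau> p \<sigma> where p: "Y \<in> cylinder \<tau>" "U p = Some \<sigma>" "prefix \<sigma> \<tau>"
        "tiny q (Suc (length p + i)) (str_code \<sigma>)"
        unfolding V_def using W_iff by blast
      then have "p \<in> P" using tiny_bound[OF q' p(4)] by (simp add: P_def dom_def)
      then show "Y \<in> (\<Union>p\<in>P. cylinder (the (U p)))" using p cylinder_antimono by fastforce
    qed
    moreover have "(\<Union>p\<in>P. cylinder (the (U p))) \<in> sets \<mu>"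
      using cylinder_in_sets[OF \<mu>] by (intro sets.countable_UN'') auto
    ultimately have "measure \<mu> (V i) \<le> measure \<mu> (\<Union>p\<in>P. cylinder (the (U p)))"
      by (rule finite_measure_mono)
    also have "\<dots> \<le> (1/2) ^ i"
      using U unfolding prefix_free_machine_def
      by (intro measure_compressible_le[OF \<mu>, of U]) (auto simp: P_def F_def)
    finally show ?thesis .
  qed
  then have "ml_test \<mu> V" using \<open>uniformly_Sigma01 V\<close> by (simp add: ml_test_def)
  then obtain i where i: "X \<notin> V i" using random unfolding ml_random_def by blast
  have "(1/2) ^ (length p + (i + 2)) \<le> F (init_seg X n)" if p: "U p = Some (init_seg X n)" for p n
  proof (rule ccontr)
    assume "\<not> (1/2) ^ (length p + (i + 2)) \<le> F (init_seg X n)"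
    then have "F (init_seg X n) < (1/2) ^ Suc (Suc (length p + i))" by simp
    then have tiny: "tiny q (Suc (length p + i)) (str_code (init_seg X n))" by (rule tiny_if[OF q'])
    define l where "l = prod_encode (str_code p, n)"
    have "n \<le> l" unfolding l_def by (rule le_prod_encode_2)
    then have "prefix (init_seg X n) (init_seg X l)"
      using take_is_prefix[of n "init_seg X l"] by (simp add: take_init_seg)
    then have "prod_encode (i, str_code (init_seg X l)) \<in> W"
      unfolding W_iff using p tiny
      by (intro exI[of _ p] exI[of _ "init_seg X n"] conjI) (simp_all add: l_def)
    then show False using i mem_cylinder_init_seg[of X l] unfolding V_def by blast
  qed
  then show ?thesis unfolding F_def by blast
qed

section \<open>Anti-complex proper sequences\<close>

lemma short_program:
  assumes "complexity U \<sigma> \<le> enat n"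
  obtains p where "U p = Some \<sigma>" "length p \<le> n"
proof -
  have "complexity U \<sigma> < enat (Suc n)" using assms by (rule le_less_trans) simp
  then obtain p where "U p = Some \<sigma>" "enat (length p) < enat (Suc n)"
    unfolding complexity_def INF_less_iff by blast
  then show thesis using that[of p] by simp
qed

theorem theorem5p5:
  fixes U :: "bool list \<Rightarrow> bool list option" and X :: "nat \<Rightarrow> bool"
  assumes "optimal_machine U"
    and "\<not> computable_seq X"
    and "anti_complex U X"
    and "proper X"
  shows "high X"
proof -
  obtain \<mu> where \<mu>: "borel_prob \<mu>" "computable_measure \<mu>" "ml_random \<mu> X"
    using assms(4) unfolding proper_def by blast
  define F where "F \<sigma> = measure \<mu> (cylinder \<sigma>)" for \<sigma>
  obtain q where q: "computable q" "approximates q F"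
    using \<mu>(2) unfolding computable_measure_def computable_real_fun_def approximates_def F_def
    by blast
  have qX: "computable_in X q" using q(1) by (rule computable_imp_computable_in)
  have pf: "prefix_free_machine U" using assms(1) by (simp add: optimal_machine_def)
  obtain c where c: "\<And>p n. U p = Some (init_seg X n) \<Longrightarrow> (1/2) ^ (length p + c) \<le> F (init_seg X n)"
    using random_complexity_lower_bound[OF pf \<mu>(1) q(1) q(2)[unfolded F_def[abs_def]] \<mu>(3)]
    unfolding F_def by metis
  have null: "\<exists>m. F (init_seg X m) < (1/2) ^ k" for k
  proof (rule ccontr)
    assume "\<nexists>m. F (init_seg X m) < (1/2) ^ k"
    then have mass: "(1/2) ^ k \<le> F (init_seg X n)" for n by (simp add: not_less)
    have "computable_seq X"
    proof (rule computable_if_not_null[OF q _ _ mass])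
      show "F \<sigma> = F (\<sigma> @ [True]) + F (\<sigma> @ [False])" for \<sigma>
        unfolding F_def by (rule measure_cylinder_split[OF \<mu>(1)])
    qed (simp add: F_def)
    then show False using assms(2) by contradiction
  qed
  have mono: "F (init_seg X n) \<le> F (init_seg X m)" if "m \<le> n" for m n
  proof -
    interpret prob_space \<mu> using \<mu>(1) by (simp add: borel_prob_def)
    have "prefix (init_seg X m) (init_seg X n)"
      using that take_is_prefix[of m "init_seg X n"] by (simp add: take_init_seg)
    then show ?thesis
      unfolding F_def by (intro finite_measure_mono cylinder_antimono cylinder_in_sets \<mu>(1))
  qed
  \<comment> \<open>The exponent \<open>2 * n\<close> outgrows \<open>n + c\<close> for the unknown constant \<open>c\<close>.\<close>
  define g where "g n = (LEAST m. tiny q (2 * n) (str_code (init_seg X m)))" for n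
  have ex: "\<exists>m. tiny q (2 * n) (str_code (init_seg X m))" for n
    using null[of "Suc (2 * n)"] tiny_if[OF q(2)] by blast
  have g: "F (init_seg X (g n)) < 2 * (1/2) ^ (2 * n)" for n
    unfolding g_def by (rule tiny_bound[OF q(2)], rule LeastI_ex[OF ex])
  show ?thesis
  proof (rule high_if_dominating)
    show "computable_in X g"
      unfolding g_def[abs_def]
      by (intro computable_intros decidable_in_tiny qX ex computable_in_init_seg[THEN computable_in_comp])
  next
    fix f assume f: "computable f"
    \<comment> \<open>An order that is at least \<open>f\<close> on positive arguments; the shift makes \<open>h 0 = 0\<close>.\<close>
    define h where "h n = (\<Sum>k<n. Suc (f (Suc k)))" for n
    have "computable h"
      unfolding computable_def h_def[abs_def]
      by (intro computable_intros f[unfolded computable_def, THEN computable_in_comp])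
    moreover have "order_fun h"
    proof -
      have "mono h" unfolding mono_iff_le_Suc by (simp add: h_def)
      moreover have "n \<le> h n" for n by (induction n) (auto simp: h_def)
      ultimately show ?thesis unfolding order_fun_def by (auto simp: h_def)
    qed
    ultimately have "\<forall>\<^sub>F n in sequentially. complexity U (init_seg X (h n)) \<le> enat n"
      using assms(3) unfolding anti_complex_def by blast
    then show "\<forall>\<^sub>F n in sequentially. f n \<le> g n"
      using eventually_ge_at_top[of "Suc c"]
    proof eventually_elim
      case (elim n)
      obtain p where p: "U p = Some (init_seg X (h n))" "length p \<le> n"
        using elim(1) by (rule short_program)
      have "F (init_seg X (g n)) < (1/2) ^ (2 * n - 1)"
        using g[of n] elim(2) by (cases n) auto
      also have "\<dots> \<le> (1/2) ^ (length p + c)"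
        using elim(2) p(2) by (intro power_decreasing) auto
      also have "\<dots> \<le> F (init_seg X (h n))" by (rule c[OF p(1)])
      finally have "h n < g n" using mono by (meson not_less)
      moreover have "f n \<le> h n" using elim(2) by (cases n) (auto simp: h_def)
      ultimately show ?case by simp
    qed
  qed
qed

end
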